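(* Let $H\in(0,1)$, $\alpha_0\in(-\pi/2,\pi/2)$, $\delta>0$, let $X=X_{\alpha_0,\delta}$ be the elementary field, whose orientation is $\vec n=(\cos\alpha_0,\sin\alpha_0)^T$. Let $\Phi:\mathbb{R}^2\to\mathbb{R}^2$ be continuously differentiable and a diffeomorphism on an open set $U\subset\mathbb{R}^2$, and let $Z_{\Phi,X}(x)=X(\Phi(x))$ be the associated Warped Anisotropic Fractional Brownian Field. Then at each point $x_0\in U$, $Z_{\Phi,X}$ admits an approximate (up to $\delta^2$) local orientation given by $$\vec n_Z(x_0)=\frac{D\Phi(x_0)^{T}\,\vec n}{\|D\Phi(x_0)^{T}\,\vec n\|},$$ where $D\Phi(x_0)$ is the Jacobian matrix of $\Phi$ at $x_0$.
   Context: Gaussian fields are real-valued, centered, indexed by $\mathbb{R}^2$. $\mathrm{j}$ is the imaginary unit; $\arg$ is taken modulo $2\pi$; $\mathbb{S}^1$ is the unit circle of $\mathbb{R}^2$ with arc length $d\Theta$. "Diffeomorphism on $U$" means $C^1$-diffeomorphism, so $D\Phi(x_0)$ is invertible for $x_0\in U$. For an $H$-self-similar Gaussian field $Y$ with stationary increments and spectral density $f_Y$, i.e. $\mathbb{E}[Y(x)Y(y)]=\int(e^{\mathrm{j}\langle x,\xi\rangle}-1)(e^{-\mathrm{j}\langle y,\xi\rangle}-1)f_Y(\xi)\,d\xi$, one has $f_Y(\xi)=\|\xi\|^{-2H-2}C_Y(\xi/\|\xi\|)$; $C_Y$ is the anisotropy function. The structure tensor of $Y$ is the $2\times2$ matrix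 $\mathbf{J}_Y$ with entries $\int_{\mathbb{S}^1}\Theta_{\ell_1}\Theta_{\ell_2}C_Y(\Theta)\,d\Theta$; an orientation of $Y$ is any unit eigenvector of $\mathbf{J}_Y$ for its largest eigenvalue. The elementary field $X_{\alpha_0,\delta}$ is the $H$-self-similar Gaussian field with stationary increments with anisotropy function $$C_X(\Theta)=\frac1{4\delta}\Big(\mathbf{1}_{[\alpha_0-\delta,\alpha_0+\delta]}(\arg\Theta)+\mathbf{1}_{[\alpha_0+\pi-\delta,\alpha_0+\pi+\delta]}(\arg\Theta)\Big).$$ A random field $Z$ is $H$-localizable at $x_0$ with tangent field the non-trivial random field $Y_{x_0}$ if $\{\rho^{-H}(Z(x_0+\rho u)-Z(x_0))\}_{u\in\mathbb{R}^2}$ converges in distribution (weak convergence of stochastic processes, continuous versions) to $\{Y_{x_0}(u)\}_u$ as $\rho\to0$. The local structure tensor $\mathbf{J}_{x_0}$ and a local orientation of $Z$ at $x_0$ are the structure tensor and an orientation of its tangent field $Y_{x_0}$. For fields depending on $\delta>0$, a unit vector $\vec m$ (independent of $\delta$) is an approximate (up to $\delta^2$) local orientation at $x_0$ if there is a constant $c>0$ independent of $\delta$ such that $\mathbf{J}_{x_0}=c\,\vec m\,\vec m^{T}+O(\delta^2)$ as $\delta\to0$. *)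

theory Defs
  imports "HOL-Probability.Probability" "HOL-Library.Landau_Symbols"
begin

section \<open>Random fields on the plane\<close>

text \<open>A field is always taken in its continuous version, so that its law lives on the space
  of continuous functions.\<close>

definition random_field :: "'a measure \<Rightarrow> (real^2 \<Rightarrow> 'a \<Rightarrow> real) \<Rightarrow> bool" where
  "random_field M Z \<longleftrightarrow> prob_space M \<and> (\<forall>x. Z x \<in> borel_measurable M) \<and>
     (\<forall>\<omega>\<in>space M. continuous_on UNIV (\<lambda>x. Z x \<omega>))"

text \<open>The first alternative is the degenerate Gaussian law.\<close>

definition centered_gaussian :: "'a measure \<Rightarrow> ('a \<Rightarrow> real) \<Rightarrow> bool" where
  "centered_gaussian M V \<longleftrightarrow>
     (AE \<omega> in M. V \<omega> = 0) \<or> (\<exists>\<sigma>>0. distributed M lborel V (normal_density 0 \<sigma>))"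

definition gaussian_field :: "'a measure \<Rightarrow> (real^2 \<Rightarrow> 'a \<Rightarrow> real) \<Rightarrow> bool" where
  "gaussian_field M Z \<longleftrightarrow> random_field M Z \<and>
     (\<forall>S a. finite S \<longrightarrow> centered_gaussian M (\<lambda>\<omega>. \<Sum>x\<in>S. a x * Z x \<omega>))"

text \<open>Two fields have the same law on the product \<open>\<sigma>\<close>-algebra iff they have the same
  finite-dimensional distributions.\<close>

definition field_law :: "'a measure \<Rightarrow> (real^2 \<Rightarrow> 'a \<Rightarrow> real) \<Rightarrow> (real^2 \<Rightarrow> real) measure" where
  "field_law M Z = distr M (\<Pi>\<^sub>M x\<in>UNIV. borel) (\<lambda>\<omega> x. Z x \<omega>)"

definition self_similar :: "real \<Rightarrow> 'a measure \<Rightarrow> (real^2 \<Rightarrow> 'a \<Rightarrow> real) \<Rightarrow> bool" where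
  "self_similar H M Z \<longleftrightarrow>
     (\<forall>\<rho>>0. field_law M (\<lambda>x. Z (\<rho> *\<^sub>R x)) = field_law M (\<lambda>x \<omega>. \<rho> powr H * Z x \<omega>))"

definition stationary_increments :: "'a measure \<Rightarrow> (real^2 \<Rightarrow> 'a \<Rightarrow> real) \<Rightarrow> bool" where
  "stationary_increments M Z \<longleftrightarrow>
     (\<forall>h. field_law M (\<lambda>x \<omega>. Z (x + h) \<omega> - Z h \<omega>) = field_law M (\<lambda>x \<omega>. Z x \<omega> - Z 0 \<omega>))"


section \<open>Spectral density, anisotropy function and structure tensor\<close>

definition spectral_kernel :: "real^2 \<Rightarrow> real^2 \<Rightarrow> real^2 \<Rightarrow> complex" where
  "spectral_kernel x y \<xi> =
     (exp (\<i> * of_real (x \<bullet> \<xi>)) - 1) * (exp (- (\<i> * of_real (y \<bullet> \<xi>))) - 1)"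

definition spectral_density ::
  "'a measure \<Rightarrow> (real^2 \<Rightarrow> 'a \<Rightarrow> real) \<Rightarrow> (real^2 \<Rightarrow> real) \<Rightarrow> bool" where
  "spectral_density M Y f \<longleftrightarrow> f \<in> borel_measurable borel \<and> (\<forall>\<xi>. 0 \<le> f \<xi>) \<and>
     (\<forall>x y. integrable lborel (\<lambda>\<xi>. spectral_kernel x y \<xi> * of_real (f \<xi>)) \<and>
        complex_of_real (LINT \<omega>|M. Y x \<omega> * Y y \<omega>) =
          (LINT \<xi>|lborel. spectral_kernel x y \<xi> * of_real (f \<xi>)))"

text \<open>Only the values of \<open>C\<close> on the unit circle matter; there \<open>C\<close> is measurable and nonnegative
  because the spectral density is.\<close>

definition anisotropy_function ::
  "real \<Rightarrow> 'a measure \<Rightarrow> (real^2 \<Rightarrow> 'a \<Rightarrow> real) \<Rightarrow> (real^2 \<Rightarrow> real) \<Rightarrow> bool" where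
  "anisotropy_function H M Y C \<longleftrightarrow>
     gaussian_field M Y \<and> self_similar H M Y \<and> stationary_increments M Y \<and>
     spectral_density M Y (\<lambda>\<xi>. norm \<xi> powr (- 2 * H - 2) * C (\<xi> /\<^sub>R norm \<xi>))"

definition circle_point :: "real \<Rightarrow> real^2" where
  "circle_point t = vector [cos t, sin t]"

text \<open>The arc length integral over the unit circle is written in its angular parametrisation.\<close>

definition structure_tensor :: "(real^2 \<Rightarrow> real) \<Rightarrow> real^2^2" where
  "structure_tensor C =
     (\<chi> i j. LINT t:{0..2*pi}|lborel.
               circle_point t $ i * circle_point t $ j * C (circle_point t))"

definition field_structure_tensor ::
  "real \<Rightarrow> 'a measure \<Rightarrow> (real^2 \<Rightarrow> 'a \<Rightarrow> real) \<Rightarrow> real^2^2 \<Rightarrow> bool" where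
  "field_structure_tensor H M Y J \<longleftrightarrow>
     (\<exists>C. anisotropy_function H M Y C \<and> J = structure_tensor C)"


section \<open>The elementary field and the warped field\<close>

definition arg_within :: "real^2 \<Rightarrow> real \<Rightarrow> real \<Rightarrow> bool" where
  "arg_within \<Theta> a b \<longleftrightarrow>
     (\<exists>k::int. Arg (Complex (\<Theta> $ 1) (\<Theta> $ 2)) + 2 * pi * of_int k \<in> {a..b})"

definition elementary_anisotropy :: "real \<Rightarrow> real \<Rightarrow> real^2 \<Rightarrow> real" where
  "elementary_anisotropy \<alpha> \<delta> \<Theta> =
     1 / (4 * \<delta>) * (of_bool (arg_within \<Theta> (\<alpha> - \<delta>) (\<alpha> + \<delta>)) +
                    of_bool (arg_within \<Theta> (\<alpha> + pi - \<delta>) (\<alpha> + pi + \<delta>)))"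

definition elementary_field ::
  "real \<Rightarrow> real \<Rightarrow> real \<Rightarrow> 'a measure \<Rightarrow> (real^2 \<Rightarrow> 'a \<Rightarrow> real) \<Rightarrow> bool" where
  "elementary_field H \<alpha> \<delta> M X \<longleftrightarrow> anisotropy_function H M X (elementary_anisotropy \<alpha> \<delta>)"

definition warped_field ::
  "(real^2 \<Rightarrow> real^2) \<Rightarrow> (real^2 \<Rightarrow> 'a \<Rightarrow> real) \<Rightarrow> real^2 \<Rightarrow> 'a \<Rightarrow> real" where
  "warped_field \<Phi> X x = X (\<Phi> x)"


section \<open>Continuously differentiable maps and diffeomorphisms\<close>

definition C1_on :: "(real^2) set \<Rightarrow> (real^2 \<Rightarrow> real^2) \<Rightarrow> bool" where
  "C1_on S f \<longleftrightarrow> (\<exists>f' :: real^2 \<Rightarrow> ((real^2) \<Rightarrow>\<^sub>L (real^2)).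
     (\<forall>x\<in>S. (f has_derivative blinfun_apply (f' x)) (at x)) \<and> continuous_on S f')"

definition C1_diffeomorphism_on :: "(real^2) set \<Rightarrow> (real^2 \<Rightarrow> real^2) \<Rightarrow> bool" where
  "C1_diffeomorphism_on U \<Phi> \<longleftrightarrow> C1_on U \<Phi> \<and> open (\<Phi> ` U) \<and>
     (\<exists>\<Psi>. C1_on (\<Phi> ` U) \<Psi> \<and> (\<forall>x\<in>U. \<Psi> (\<Phi> x) = x))"


section \<open>Convergence in distribution and tangent fields\<close>

text \<open>Continuity of a functional on the space of continuous functions with the topology of
  uniform convergence on compact sets. This topology is metrizable, so sequential continuity
  is continuity.\<close>

definition continuous_functional :: "((real^2 \<Rightarrow> real) \<Rightarrow> real) \<Rightarrow> bool" where
  "continuous_functional F \<longleftrightarrow>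
     (\<forall>fs f. (\<forall>n. continuous_on UNIV (fs n)) \<longrightarrow> continuous_on UNIV f \<longrightarrow>
        (\<forall>K. compact K \<longrightarrow> uniform_limit K fs f sequentially) \<longrightarrow>
        (\<lambda>n. F (fs n)) \<longlonglongrightarrow> F f)"

text \<open>Weak convergence as \<open>\<rho>\<close> decreases to \<open>0\<close>. A continuous functional is Borel, and the Borel sets
  of the space of continuous functions are generated by the evaluations, so the integrands are
  measurable.\<close>

definition field_converges_in_distribution ::
  "'a measure \<Rightarrow> (real \<Rightarrow> real^2 \<Rightarrow> 'a \<Rightarrow> real) \<Rightarrow>
   'b measure \<Rightarrow> (real^2 \<Rightarrow> 'b \<Rightarrow> real) \<Rightarrow> bool" where
  "field_converges_in_distribution M V N Y \<longleftrightarrow>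
     (\<forall>F. continuous_functional F \<longrightarrow> (\<exists>B. \<forall>g. \<bar>F g\<bar> \<le> B) \<longrightarrow>
        ((\<lambda>\<rho>. LINT \<omega>|M. F (\<lambda>u. V \<rho> u \<omega>)) \<longlongrightarrow> (LINT \<omega>|N. F (\<lambda>u. Y u \<omega>))) (at_right 0))"

definition localizable_at ::
  "real \<Rightarrow> 'a measure \<Rightarrow> (real^2 \<Rightarrow> 'a \<Rightarrow> real) \<Rightarrow> real^2 \<Rightarrow>
   'b measure \<Rightarrow> (real^2 \<Rightarrow> 'b \<Rightarrow> real) \<Rightarrow> bool" where
  "localizable_at H M Z x0 N Y \<longleftrightarrow>
     random_field M Z \<and> random_field N Y \<and> \<not> (\<forall>u. AE \<omega> in N. Y u \<omega> = 0) \<and>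
     field_converges_in_distribution M
       (\<lambda>\<rho> u \<omega>. \<rho> powr (- H) * (Z (x0 + \<rho> *\<^sub>R u) \<omega> - Z x0 \<omega>)) N Y"


section \<open>Local structure tensor and approximate local orientation\<close>

text \<open>A tangent field is only determined up to its law; it may live on any probability space
  \<open>N\<close> over the sample type.\<close>

definition local_structure_tensor ::
  "real \<Rightarrow> 'a measure \<Rightarrow> (real^2 \<Rightarrow> 'a \<Rightarrow> real) \<Rightarrow> real^2 \<Rightarrow> real^2^2 \<Rightarrow> bool" where
  "local_structure_tensor H M Z x0 J \<longleftrightarrow>
     (\<exists>(N :: 'a measure) Y. localizable_at H M Z x0 N Y \<and> field_structure_tensor H N Y J)"

text \<open>The family \<open>Z \<delta>\<close> must have a local structure tensor at \<open>x0\<close> for every \<open>\<delta> > 0\<close>, and the expansion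
  is required of every choice of local structure tensors, so nothing depends on the choice of
  tangent field or of anisotropy function.\<close>

definition approximate_local_orientation ::
  "real \<Rightarrow> (real \<Rightarrow> 'a measure) \<Rightarrow> (real \<Rightarrow> real^2 \<Rightarrow> 'a \<Rightarrow> real) \<Rightarrow> real^2 \<Rightarrow> real^2 \<Rightarrow> bool" where
  "approximate_local_orientation H M Z x0 m \<longleftrightarrow> norm m = 1 \<and>
     (\<forall>\<delta>>0. \<exists>J. local_structure_tensor H (M \<delta>) (Z \<delta>) x0 J) \<and>
     (\<exists>c>0. \<forall>J. (\<forall>\<delta>>0. local_structure_tensor H (M \<delta>) (Z \<delta>) x0 (J \<delta>)) \<longrightarrow>
        (\<lambda>\<delta>. norm (J \<delta> - c *\<^sub>R (\<chi> i j. m $ i * m $ j))) \<in> O[at_right 0](\<lambda>\<delta>. \<delta>\<^sup>2))"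

end

theory Submission
  imports Defs
begin

text \<open>By stationarity of the increments and self-similarity, the rescaled increments of the warped
  field at \<open>x0\<close> have the law of \<open>u \<mapsto> X ((\<Phi> (x0 + \<rho> u) - \<Phi> x0) / \<rho>) - X 0\<close>, whose paths converge
  uniformly on compact sets to \<open>u \<mapsto> X (A u)\<close>, where \<open>A\<close> is the Jacobian matrix at \<open>x0\<close>. A linear
  change of variables gives an anisotropy function of this tangent field. The map
  \<open>\<Theta> \<mapsto> B \<Theta> / \<parallel>B \<Theta>\<parallel>\<close>, with \<open>B\<close> the inverse transpose of \<open>A\<close>, turns its structure tensor into the integral
  of \<open>\<parallel>T \<Theta>\<parallel> powr (2 H - 2) (T \<Theta>) (T \<Theta>)\<^sup>T\<close>, \<open>T\<close> being the transpose of \<open>A\<close>, against the elementary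
  anisotropy function. This is the mean of a smooth function over an interval of radius \<open>\<delta>\<close> around \<open>\<alpha>0\<close>,
  that is, its value at the centre up to an error of order \<open>\<delta>\<^sup>2\<close>.

  Nothing depends on the choice of the tangent field or of its anisotropy function \<open>C\<close>: the
  variances of a tangent field are determined by weak convergence, the variance at \<open>u\<close> is a constant
  times the integral of \<open>\<bar>u \<bullet> \<Theta>\<bar> powr (2 H) C(\<Theta>)\<close>, and averaging it over the unit vectors \<open>u\<close> against
  \<open>1\<close>, \<open>cos (2 s)\<close> and \<open>sin (2 s)\<close> recovers the Fourier modes of \<open>C\<close> that enter the structure tensor.\<close>

section \<open>Laws of random fields\<close>

text \<open>Self-similarity and stationarity are equalities of laws on the product sigma-algebra,
  whereas weak convergence tests functionals of whole paths; path continuity bridges the gap. Since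
  the equal-law replacements all live on the space carrying the elementary field, their convergence
  is pathwise there, and dominated convergence takes the place of a tightness argument. The other
  obstacle is that a field does not determine its anisotropy function pointwise. Only the angular
  Fourier modes of order 0 and 2 enter the structure tensor, and they can be recovered because the
  kernel |cos|^(2H) has positive coefficients of both orders. The variances are read off from the
  bounded functional cos (f u), as E cos V = exp (- Var V / 2) for a centered Gaussian V. The
  exponent 2 H - 2 is forced by homogeneity: an integral over the circle transforms under a linear
  map without extra weight only for integrands of degree -2. The error is quadratic because the
  linear Taylor term cancels over a symmetric interval, and the value at the centre yields the
  constant c = ||T n||^(2H).\<close>

lemma finite_net_exists:
  fixes r e :: real
  assumes "0 < e"
  shows "\<exists>G::(real^2) set. finite G \<and> cball 0 r \<subseteq> (\<Union>p\<in>G. ball p e)"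
  using seq_compact_imp_totally_bounded[OF compact_imp_seq_compact[of "cball 0 r :: (real^2) set"]] assms
  by auto

text \<open>Shepard interpolation on a finite net approximates a path by a function of finitely many of its
  values; this is how functionals of the path are seen by the product \<open>\<sigma>\<close>-algebra. The lower bound in
  the denominator of the weights only keeps them continuous far from the net.\<close>

definition net :: "nat \<Rightarrow> (real^2) set" where
  "net n = (SOME G. finite G \<and> cball 0 (real n) \<subseteq> (\<Union>p\<in>G. ball p (1 / (2 * (real n + 1)))))"

lemma net_cover: "finite (net n)" "cball 0 (real n) \<subseteq> (\<Union>p\<in>net n. ball p (1 / (2 * (real n + 1))))"
  using someI_ex[OF finite_net_exists[of "1 / (2 * (real n + 1))" "real n"]] unfolding net_def by auto

definition bump :: "nat \<Rightarrow> real^2 \<Rightarrow> real^2 \<Rightarrow> real" where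
  "bump n p x = max 0 (1 / (real n + 1) - dist x p)"

definition net_weight :: "nat \<Rightarrow> real^2 \<Rightarrow> real^2 \<Rightarrow> real" where
  "net_weight n p x = bump n p x / max (1 / (2 * (real n + 1))) (\<Sum>q\<in>net n. bump n q x)"

definition interpolate :: "nat \<Rightarrow> (real^2 \<Rightarrow> real) \<Rightarrow> real^2 \<Rightarrow> real" where
  "interpolate n f x = (\<Sum>p\<in>net n. f p * net_weight n p x)"

lemma continuous_bump [continuous_intros]: "continuous_on S (bump n p)"
  unfolding bump_def by (intro continuous_intros)

lemma continuous_net_weight [continuous_intros]: "continuous_on S (net_weight n p)"
  unfolding net_weight_def
  by (intro continuous_intros) (auto simp: max_def field_simps)

lemma continuous_interpolate [continuous_intros]: "continuous_on S (interpolate n f)"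
  unfolding interpolate_def by (intro continuous_intros)

lemma bump_nonneg: "0 \<le> bump n p x"
  by (simp add: bump_def)

lemma net_weight_nonneg: "0 \<le> net_weight n p x"
  unfolding net_weight_def by (intro divide_nonneg_nonneg bump_nonneg) (simp add: le_max_iff_disj)

lemma net_weight_eq_0: "1 / (real n + 1) \<le> dist x p \<Longrightarrow> net_weight n p x = 0"
  by (simp add: net_weight_def bump_def)

text \<open>The covering balls have half the radius of the bumps, so some bump is at least 1 / (2 (n
  + 1)) at \<open>x\<close>. This is exactly the floor in the denominator of
  \<open>net_weight\<close>, so the maximum there is the sum itself.\<close>

lemma sum_net_weight:
  assumes "norm x \<le> real n"
  shows "(\<Sum>p\<in>net n. net_weight n p x) = 1"
proof -
  obtain p where p: "p \<in> net n" "dist p x < 1 / (2 * (real n + 1))"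
    using net_cover(2)[of n] assms by (force simp: subset_iff)
  have "1 / (2 * (real n + 1)) = 1 / (real n + 1) - 1 / (2 * (real n + 1))"
    by (simp add: field_simps)
  also have "\<dots> \<le> bump n p x"
    using p(2) by (auto simp: bump_def dist_commute)
  also have "\<dots> \<le> (\<Sum>q\<in>net n. bump n q x)"
    using p(1) net_cover(1) by (intro member_le_sum bump_nonneg)
  finally have le: "1 / (2 * (real n + 1)) \<le> (\<Sum>q\<in>net n. bump n q x)" .
  then have "0 < (\<Sum>q\<in>net n. bump n q x)"
    by (rule less_le_trans[rotated]) simp
  with le show ?thesis
    unfolding net_weight_def sum_divide_distrib[symmetric] by (simp add: max_def)
qed

lemma interpolate_uniform_limit:
  assumes "continuous_on UNIV f" "compact K"
  shows "uniform_limit K (\<lambda>n. interpolate n f) f sequentially"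
proof (rule uniform_limitI)
  fix e :: real assume "0 < e"
  obtain R where R: "\<And>x. x \<in> K \<Longrightarrow> norm x \<le> R"
    using compact_imp_bounded[OF assms(2)] by (auto simp: bounded_iff)
  \<comment> \<open>Net points with nonzero weight at a point of \<open>K\<close> may lie outside
    \<open>K\<close>, but within distance 1 of it for large \<open>n\<close>; hence the radius R +
    1.\<close>
  have "uniformly_continuous_on (cball 0 (R + 1)) f"
    by (intro compact_uniformly_continuous continuous_on_subset[OF assms(1)]) auto
  then obtain d where d: "0 < d"
    "\<And>x y. x \<in> cball 0 (R + 1) \<Longrightarrow> y \<in> cball 0 (R + 1) \<Longrightarrow> dist y x < d \<Longrightarrow> dist (f y) (f x) < e / 2"
    unfolding uniformly_continuous_on_def using \<open>0 < e\<close> by (meson half_gt_zero)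
  have "(\<lambda>n. 1 / (real n + 1)) \<longlonglongrightarrow> 0"
    using LIMSEQ_inverse_real_of_nat by (simp add: inverse_eq_divide add.commute)
  then have "\<forall>\<^sub>F n in sequentially. 1 / (real n + 1) < min d 1"
    using d(1) by (intro order_tendstoD) auto
  moreover have "\<forall>\<^sub>F n in sequentially. R \<le> real n"
    by (meson eventually_sequentiallyI nat_ceiling_le_eq)
  ultimately show "\<forall>\<^sub>F n in sequentially. \<forall>x\<in>K. dist (interpolate n f x) (f x) < e"
  proof eventually_elim
    case (elim n)
    show ?case
    proof
      fix x assume "x \<in> K"
      note x = R[OF this]
      have S: "(\<Sum>p\<in>net n. net_weight n p x) = 1" by (rule sum_net_weight) (use x elim in linarith)
      have le: "\<bar>f p - f x\<bar> * net_weight n p x \<le> e / 2 * net_weight n p x" for p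
      proof (cases "1 / (real n + 1) \<le> dist x p")
        case False
        then have "dist p x < d" "dist p x < 1"
          using elim(1) unfolding min_less_iff_conj by (simp_all only: dist_commute[of x p], linarith+)
        moreover have "norm p \<le> norm x + dist p x"
          by (metis add.commute dist_norm norm_triangle_sub)
        ultimately have "dist (f p) (f x) < e / 2"
          using x by (intro d) auto
        then show ?thesis
          by (intro mult_right_mono net_weight_nonneg) (simp add: dist_real_def)
      qed (simp add: net_weight_eq_0)
      have "interpolate n f x - f x = (\<Sum>p\<in>net n. (f p - f x) * net_weight n p x)"
        unfolding interpolate_def left_diff_distrib sum_subtractf by (simp add: S flip: sum_distrib_left)
      also have "\<bar>\<dots>\<bar> \<le> (\<Sum>p\<in>net n. e / 2 * net_weight n p x)"
        by (rule order_trans[OF sum_abs]) (auto simp only: abs_mult abs_of_nonneg[OF net_weight_nonneg] intro!: sum_mono le)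
      also have "\<dots> = e / 2" unfolding sum_distrib_left[symmetric] S by simp
      finally show "dist (interpolate n f x) (f x) < e" using \<open>0 < e\<close> by (simp add: dist_real_def)
    qed
  qed
qed

lemma uniform_limit_sum:
  fixes f :: "'i \<Rightarrow> 'n \<Rightarrow> 'a \<Rightarrow> 'b::real_normed_vector"
  assumes "\<And>i. i \<in> I \<Longrightarrow> uniform_limit S (f i) (l i) F"
  shows "uniform_limit S (\<lambda>n x. \<Sum>i\<in>I. f i n x) (\<lambda>x. \<Sum>i\<in>I. l i x) F"
  using assms by (induction I rule: infinite_finite_induct) (auto intro!: uniform_limit_intros)

lemma continuous_functionalD:
  assumes "continuous_functional F" "\<And>n. continuous_on UNIV (fs n)" "continuous_on UNIV f"
    "\<And>K. compact K \<Longrightarrow> uniform_limit K fs f sequentially"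
  shows "(\<lambda>n. F (fs n)) \<longlonglongrightarrow> F f"
  using assms(1)[unfolded continuous_functional_def, rule_format, OF assms(2-4)] .

section \<open>Expectations of functionals of the path\<close>

lemma measurable_functional_interpolate:
  assumes F: "continuous_functional F"
  shows "(\<lambda>f. F (interpolate n f)) \<in> borel_measurable (\<Pi>\<^sub>M x\<in>UNIV. borel)"
proof -
  obtain xs where xs: "set xs = net n" "distinct xs"
    using finite_distinct_list[OF net_cover(1)] by blast
  \<comment> \<open>The finitely many values are padded by zeros to a sequence. On a countable
    product the Borel sets of the product topology are those of the product sigma-algebra, so
    continuity of \<open>F (P a)\<close> in \<open>a\<close> yields measurability.\<close>
  define P where "P a x = (\<Sum>i<length xs. a i * net_weight n (xs ! i) x)" for a :: "nat \<Rightarrow> real" and x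
  have interp: "interpolate n f = P (\<lambda>i. if i < length xs then f (xs ! i) else 0)" for f
    unfolding interpolate_def P_def xs(1)[symmetric] sum.distinct_set_conv_list[OF xs(2)]
    by (subst sum_list_sum_nth) (auto simp: atLeast0LessThan)
  have "continuous_on UNIV (\<lambda>a. F (P a))"
    unfolding continuous_on_sequentially
  proof (intro allI ballI impI, elim conjE)
    fix as :: "nat \<Rightarrow> nat \<Rightarrow> real" and a
    assume lim: "as \<longlonglongrightarrow> a"
    have lim: "(\<lambda>k. as k i) \<longlonglongrightarrow> a i" for i
      using continuous_on_tendsto_compose[OF continuous_on_product_coordinates lim] by simp
    have "uniform_limit K (\<lambda>k. P (as k)) (P a) sequentially" if "compact K" for K
      unfolding P_def
    proof (intro uniform_limit_sum)
      fix i
      have "bounded (net_weight n (xs ! i) ` K)"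
        by (intro compact_imp_bounded compact_continuous_image continuous_intros that)
      moreover have "uniform_limit K (\<lambda>k x. as k i) (\<lambda>x. a i) sequentially"
        using lim[of i] by (auto simp: uniform_limit_iff tendsto_iff elim: eventually_mono)
      ultimately show "uniform_limit K (\<lambda>k x. as k i * net_weight n (xs ! i) x)
          (\<lambda>x. a i * net_weight n (xs ! i) x) sequentially"
        by (intro uniform_lim_mult uniform_limit_const) (auto simp: bounded_iff)
    qed
    moreover have "continuous_on UNIV (P b)" for b
      unfolding P_def by (intro continuous_intros)
    ultimately show "((\<lambda>a. F (P a)) \<circ> as) \<longlonglongrightarrow> F (P a)"
      unfolding o_def by (intro continuous_functionalD[OF F])
  qed
  then have "(\<lambda>a. F (P a)) \<in> borel_measurable (borel :: (nat \<Rightarrow> real) measure)"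
    by (rule borel_measurable_continuous_onI)
  then have "(\<lambda>a. F (P a)) \<in> borel_measurable (\<Pi>\<^sub>M i\<in>UNIV. borel)"
    using measurable_cong_sets[OF sets_PiM_equal_borel[where 'a = nat and 'b = real] refl] by blast
  moreover have "(\<lambda>f i. if i < length xs then f (xs ! i) else 0)
      \<in> measurable (\<Pi>\<^sub>M x\<in>(UNIV :: (real^2) set). borel) (\<Pi>\<^sub>M i\<in>(UNIV :: nat set). (borel :: real measure))"
    by (intro measurable_PiM_single') auto
  ultimately show ?thesis
    unfolding interp by (rule measurable_compose[rotated])
qed

lemma measurable_field:
  assumes "random_field M V"
  shows "(\<lambda>\<omega> x. V x \<omega>) \<in> measurable M (\<Pi>\<^sub>M x\<in>UNIV. borel)"
  using assms by (intro measurable_PiM_single') (auto simp: random_field_def)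

lemma functional_interpolate_tendsto:
  assumes "continuous_functional F" "random_field M V" "\<omega> \<in> space M"
  shows "(\<lambda>n. F (interpolate n (\<lambda>x. V x \<omega>))) \<longlonglongrightarrow> F (\<lambda>x. V x \<omega>)"
  using assms(2,3) by (intro continuous_functionalD[OF assms(1)] interpolate_uniform_limit continuous_interpolate)
    (auto simp: random_field_def)

lemma measurable_continuous_functional:
  assumes F: "continuous_functional F" and V: "random_field M V"
  shows "(\<lambda>\<omega>. F (\<lambda>x. V x \<omega>)) \<in> borel_measurable M"
  by (rule borel_measurable_LIMSEQ_real[OF functional_interpolate_tendsto[OF F V]
      measurable_compose[OF measurable_field[OF V] measurable_functional_interpolate[OF F]]])

lemma expectation_interpolate_tendsto:
  assumes F: "continuous_functional F" and B: "\<And>g. \<bar>F g\<bar> \<le> B" and V: "random_field M V"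
  shows "(\<lambda>n. LINT \<omega>|M. F (interpolate n (\<lambda>x. V x \<omega>))) \<longlonglongrightarrow> (LINT \<omega>|M. F (\<lambda>x. V x \<omega>))"
proof (rule integral_dominated_convergence)
  interpret prob_space M using V by (simp add: random_field_def)
  show "integrable M (\<lambda>\<omega>. B)" by simp
  show "(\<lambda>\<omega>. F (\<lambda>x. V x \<omega>)) \<in> borel_measurable M"
    by (rule measurable_continuous_functional[OF F V])
  show "(\<lambda>\<omega>. F (interpolate n (\<lambda>x. V x \<omega>))) \<in> borel_measurable M" for n
    by (rule measurable_compose[OF measurable_field[OF V] measurable_functional_interpolate[OF F]])
  show "AE \<omega> in M. (\<lambda>n. F (interpolate n (\<lambda>x. V x \<omega>))) \<longlonglongrightarrow> F (\<lambda>x. V x \<omega>)"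
    using functional_interpolate_tendsto[OF F V] by (rule AE_I2)
  show "AE \<omega> in M. norm (F (interpolate n (\<lambda>x. V x \<omega>))) \<le> B" for n
    using B by simp
qed

text \<open>Both expectations are limits of expectations of \<open>F\<close> after interpolation;
  those are integrals of a measurable function on the product space, where the two laws
  coincide.\<close>

lemma expectation_eq_of_law_eq:
  assumes F: "continuous_functional F" and B: "\<And>g. \<bar>F g\<bar> \<le> B"
    and V: "random_field M V" and W: "random_field N W" and eq: "field_law M V = field_law N W"
  shows "(LINT \<omega>|M. F (\<lambda>x. V x \<omega>)) = (LINT \<omega>|N. F (\<lambda>x. W x \<omega>))"
proof (rule LIMSEQ_unique[OF expectation_interpolate_tendsto[OF F B V]])
  have "(LINT \<omega>|M. F (interpolate n (\<lambda>x. V x \<omega>))) = (LINT \<omega>|N. F (interpolate n (\<lambda>x. W x \<omega>)))" for n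
    using arg_cong[OF eq, of "\<lambda>L. LINT f|L. F (interpolate n f)"]
    by (simp add: field_law_def integral_distr[OF measurable_field measurable_functional_interpolate] F V W)
  then show "(\<lambda>n. LINT \<omega>|M. F (interpolate n (\<lambda>x. V x \<omega>))) \<longlonglongrightarrow> (LINT \<omega>|N. F (\<lambda>x. W x \<omega>))"
    using expectation_interpolate_tendsto[OF F B W] by simp
qed

lemma field_law_transform:
  assumes eq: "field_law M V = field_law N W"
    and V: "\<And>x. V x \<in> borel_measurable M" and W: "\<And>x. W x \<in> borel_measurable N"
    and T: "\<And>x. (\<lambda>f. T f x) \<in> borel_measurable (\<Pi>\<^sub>M x\<in>UNIV. borel)"
  shows "field_law M (\<lambda>x \<omega>. T (\<lambda>y. V y \<omega>) x) = field_law N (\<lambda>x \<omega>. T (\<lambda>y. W y \<omega>) x)"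
proof -
  have V': "(\<lambda>\<omega> x. V x \<omega>) \<in> measurable M (\<Pi>\<^sub>M x\<in>UNIV. borel)"
    and W': "(\<lambda>\<omega> x. W x \<omega>) \<in> measurable N (\<Pi>\<^sub>M x\<in>UNIV. borel)"
    using V W by (auto intro!: measurable_PiM_single')
  have T': "T \<in> measurable (\<Pi>\<^sub>M x\<in>UNIV. borel) (\<Pi>\<^sub>M x\<in>UNIV. borel)"
    using T by (intro measurable_PiM_single'[where f = "\<lambda>x f. T f x", simplified]) auto
  show ?thesis
    using arg_cong[OF eq, of "\<lambda>L. distr L (\<Pi>\<^sub>M x\<in>UNIV. borel) T"]
    by (simp add: field_law_def distr_distr[OF T' V'] distr_distr[OF T' W'] o_def)
qed

section \<open>Linear and polar changes of variables\<close>

text \<open>The image under \<open>g\<close> of the measure with density |det g'| on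
  \<open>S\<close> is identified with Lebesgue measure on boxes, by the formula for the measure of a
  differentiable injective image. Allowing \<open>g\<close> to miss a null set makes room for polar
  coordinates.\<close>

lemma nn_integral_change_of_variables:
  fixes g :: "real^'n::{finite,wellorder} \<Rightarrow> real^'n::_" and h :: "real^'n::_ \<Rightarrow> ennreal"
  assumes S [measurable]: "S \<in> sets borel" and g [measurable]: "g \<in> borel_measurable borel"
    and der: "\<And>x. x \<in> S \<Longrightarrow> (g has_derivative g' x) (at x within S)" and inj: "inj_on g S"
    and negl: "negligible (UNIV - g ` S)"
    and d [measurable]: "(\<lambda>x. \<bar>det (matrix (g' x))\<bar>) \<in> borel_measurable borel"
    and h [measurable]: "h \<in> borel_measurable borel"
  shows "(\<integral>\<^sup>+x. h x \<partial>lborel)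
    = (\<integral>\<^sup>+x. indicator S x * (ennreal \<bar>det (matrix (g' x))\<bar> * h (g x)) \<partial>lborel)"
proof -
  let ?d = "\<lambda>x. \<bar>det (matrix (g' x))\<bar>"
  let ?M = "distr (density lborel (\<lambda>x. indicator S x * ennreal (?d x))) borel g"
  have "lborel = ?M"
  proof (rule lborel_eqI)
    fix l u :: "real^'n::_" assume le: "\<And>b. b \<in> Basis \<Longrightarrow> l \<bullet> b \<le> u \<bullet> b"
    let ?T = "S \<inter> g -` box l u"
    have T: "?T \<in> sets borel"
      using measurable_sets_borel[OF g, of "box l u"] by auto
    have neg: "negligible (box l u - g ` ?T \<union> (g ` ?T - box l u))"
      by (rule negligible_subset[OF negl]) auto
    have im: "g ` ?T \<in> lmeasurable" "measure lebesgue (g ` ?T) = measure lebesgue (box l u)"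
      using lmeasurable_negligible_symdiff[OF _ neg] measure_negligible_symdiff[OF _ neg] by auto
    have "(?d has_integral measure lebesgue (box l u)) ?T"
      using has_measure_differentiable_image[of ?T g g' "measure lebesgue (box l u)"] im T
        has_derivative_subset[OF der, of _ ?T] inj_on_subset[OF inj] by (auto simp: sets_completionI_sets)
    then have I: "(\<integral>\<^sup>+x. ennreal (indicator ?T x * ?d x) \<partial>lborel) = ennreal (measure lebesgue (box l u))"
      by (intro nn_integral_has_integral_lebesgue) auto
    have "emeasure ?M (box l u) = (\<integral>\<^sup>+x. indicator S x * ennreal (?d x) * indicator (g -` box l u) x \<partial>lborel)"
      using measurable_sets_borel[OF g, of "box l u"]
      by (subst emeasure_distr) (simp_all add: emeasure_density)
    also have "\<dots> = (\<integral>\<^sup>+x. ennreal (indicator ?T x * ?d x) \<partial>lborel)"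
      by (intro nn_integral_cong) (auto simp: indicator_def)
    also have "\<dots> = (\<Prod>b\<in>Basis. (u - l) \<bullet> b)"
      unfolding I using le by simp
    finally show "emeasure ?M (box l u) = (\<Prod>b\<in>Basis. (u - l) \<bullet> b)" .
  qed simp
  then have "(\<integral>\<^sup>+x. h x \<partial>lborel) = (\<integral>\<^sup>+x. h x \<partial>?M)"
    by (rule arg_cong[where f = "\<lambda>M. integral\<^sup>N M h"])
  also have "\<dots> = (\<integral>\<^sup>+x. indicator S x * ennreal (?d x) * h (g x) \<partial>lborel)"
    by (subst nn_integral_distr, simp_all, subst nn_integral_density, simp_all)
  finally show ?thesis by (simp only: mult.assoc)
qed

lemma nn_integral_linear_change_of_variables:
  fixes A :: "real^'n::{finite,wellorder}^'n::_" and h :: "real^'n::_ \<Rightarrow> ennreal"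
  assumes "invertible A" and h: "h \<in> borel_measurable borel"
  shows "(\<integral>\<^sup>+x. h x \<partial>lborel) = ennreal \<bar>det A\<bar> * (\<integral>\<^sup>+x. h (A *v x) \<partial>lborel)"
proof -
  have meas: "(\<lambda>x. A *v x) \<in> borel_measurable borel"
    by (intro borel_measurable_continuous_onI matrix_vector_mult_linear_continuous_on)
  have "bij ((*v) A)"
    using assms(1) by (simp add: invertible_eq_bij)
  then have "(\<integral>\<^sup>+x. h x \<partial>lborel) = (\<integral>\<^sup>+x. indicator UNIV x * (ennreal \<bar>det (matrix ((*v) A))\<bar> * h (A *v x)) \<partial>lborel)"
    by (intro nn_integral_change_of_variables meas h)
      (auto simp: bij_def linear_imp_has_derivative)
  then show ?thesis
    using measurable_compose[OF meas h] by (simp add: nn_integral_cmult)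
qed

lemma measurable_vector_prod:
  "(\<lambda>(x, y). vector [x, y] :: real^2) \<in> borel_measurable (lborel \<Otimes>\<^sub>M lborel)"
proof -
  have *: "(\<lambda>(x, y). vector [x, y] :: real^2) = (\<lambda>p. fst p *\<^sub>R axis 1 1 + snd p *\<^sub>R axis 2 1)"
    by (auto simp: fun_eq_iff vec_eq_iff forall_2 axis_def)
  show ?thesis unfolding * by measurable
qed

text \<open>Tonelli's theorem is about pair measures; this identification lets it separate the
  radius from the angle.\<close>

lemma lborel_eq_distr_vector_prod:
  "lborel = distr (lborel \<Otimes>\<^sub>M lborel) borel (\<lambda>(x, y). vector [x, y] :: real^2)"
proof (rule lborel_eqI)
  fix l u :: "real^2" assume le: "\<And>b. b \<in> Basis \<Longrightarrow> l \<bullet> b \<le> u \<bullet> b"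
  have le': "l $ 1 \<le> u $ 1" "l $ 2 \<le> u $ 2"
    using le[of "axis 1 1"] le[of "axis 2 1"] by (auto simp: inner_axis Basis_vec_def)
  have B: "(Basis :: (real^2) set) = {axis 1 1, axis 2 1}"
    by (auto simp: Basis_vec_def UNIV_2)
  have "(\<lambda>(x, y). vector [x, y] :: real^2) -` box l u \<inter> space (lborel \<Otimes>\<^sub>M lborel)
      = {l$1<..<u$1} \<times> {l$2<..<u$2}"
    by (auto simp: mem_box_cart forall_2 space_pair_measure)
  then have "emeasure (distr (lborel \<Otimes>\<^sub>M lborel) borel (\<lambda>(x, y). vector [x, y])) (box l u)
      = emeasure (lborel \<Otimes>\<^sub>M lborel) ({l$1<..<u$1} \<times> {l$2<..<u$2})"
    by (subst emeasure_distr[OF measurable_vector_prod]) auto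
  also have "\<dots> = ennreal (u$1 - l$1) * ennreal (u$2 - l$2)"
    by (subst lborel.emeasure_pair_measure_Times) (auto simp: le')
  also have "\<dots> = (\<Prod>b\<in>Basis. (u - l) \<bullet> b)"
    using le' by (simp add: B axis_eq_axis inner_axis ennreal_mult)
  finally show "emeasure (distr (lborel \<Otimes>\<^sub>M lborel) borel (\<lambda>(x, y). vector [x, y])) (box l u)
      = (\<Prod>b\<in>Basis. (u - l) \<bullet> b)" .
qed simp

section \<open>Polar coordinates in the plane\<close>

definition polar :: "real^2 \<Rightarrow> real^2" where
  "polar p = p $ 1 *\<^sub>R circle_point (p $ 2)"

lemma circle_point_nth [simp]: "circle_point t $ 1 = cos t" "circle_point t $ 2 = sin t"
  by (simp_all add: circle_point_def)

lemma norm_vec2: "norm (x :: real^2) = sqrt ((x$1)\<^sup>2 + (x$2)\<^sup>2)"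
  by (simp add: norm_vec_def L2_set_def sum_2)

lemma norm_circle_point [simp]: "norm (circle_point t) = 1"
  by (simp add: norm_vec2)

lemma circle_point_axis: "circle_point t = cos t *\<^sub>R axis 1 1 + sin t *\<^sub>R axis 2 1"
  by (simp add: vec_eq_iff forall_2 axis_def)

lemma continuous_circle_point [continuous_intros]:
  fixes f :: "'a::t2_space \<Rightarrow> real"
  shows "continuous_on S f \<Longrightarrow> continuous_on S (\<lambda>x. circle_point (f x))"
  unfolding circle_point_axis by (auto intro!: continuous_intros)

lemma measurable_circle_point [measurable]: "circle_point \<in> borel_measurable borel"
  by (intro borel_measurable_continuous_onI continuous_intros)

lemma measurable_polar [measurable]: "polar \<in> borel_measurable borel"
  unfolding polar_def by (intro borel_measurable_continuous_onI continuous_intros)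

lemma polar_has_derivative:
  "(polar has_derivative (\<lambda>h. h $ 1 *\<^sub>R circle_point (p $ 2)
     + (p $ 1 * h $ 2) *\<^sub>R vector [- sin (p $ 2), cos (p $ 2)])) (at p within S)"
proof -
  have v: "vector [- sin t, cos t] = (- sin t) *\<^sub>R axis 1 1 + cos t *\<^sub>R (axis 2 1 :: real^2)" for t :: real
    by (simp add: vec_eq_iff forall_2 axis_def)
  show ?thesis
    unfolding polar_def circle_point_axis v
    by (auto intro!: derivative_eq_intros bounded_linear.has_derivative[OF bounded_linear_vec_nth]
        simp: fun_eq_iff algebra_simps)
qed

lemma det_polar_derivative:
  "det (matrix (\<lambda>h. h $ 1 *\<^sub>R circle_point t + (r * h $ 2) *\<^sub>R vector [- sin t, cos t]) :: real^2^2) = r"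
proof -
  have "r * (cos t * cos t) + r * (sin t * sin t) = r * ((cos t)\<^sup>2 + (sin t)\<^sup>2)"
    unfolding power2_eq_square by (simp only: distrib_left)
  then show ?thesis by (simp add: det_2 matrix_def axis_def algebra_simps)
qed

definition polar_domain :: "(real^2) set" where
  "polar_domain = {p. 0 < p $ 1 \<and> 0 < p $ 2 \<and> p $ 2 < 2 * pi}"

lemma polar_domain_borel [measurable]: "polar_domain \<in> sets borel"
  unfolding polar_domain_def by (intro borel_open open_Collect_conj open_Collect_less continuous_intros)

lemma norm_polar: "norm (polar p) = \<bar>p $ 1\<bar>"
  by (simp add: polar_def)

lemma inj_on_polar: "inj_on polar polar_domain"
proof (rule inj_onI)
  fix p q assume p: "p \<in> polar_domain" and q: "q \<in> polar_domain" and eq: "polar p = polar q"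
  have r: "p $ 1 = q $ 1"
    using norm_polar[of p] norm_polar[of q] eq p q by (auto simp: polar_domain_def)
  then have "circle_point (p $ 2) = circle_point (q $ 2)"
    using eq p by (simp add: polar_def polar_domain_def)
  then have "cos (p $ 2) = cos (q $ 2)" "sin (p $ 2) = sin (q $ 2)"
    by (metis circle_point_nth)+
  then have "p $ 2 = q $ 2"
  proof -
    obtain n :: int where n: "p $ 2 = q $ 2 + 2 * pi * n"
      using sin_cos_eq_iff[of "p$2" "q$2"] \<open>cos _ = _\<close> \<open>sin _ = _\<close> by auto
    then have "2 * pi * real_of_int n < 2 * pi * 1" "2 * pi * (- 1) < 2 * pi * real_of_int n"
      using p q unfolding polar_domain_def mem_Collect_eq by linarith+
    then have "n = 0"
      unfolding mult_less_cancel_left_pos[OF pi_gt_zero[THEN mult_pos_pos[OF zero_less_numeral]]] by linarith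
    with n show ?thesis by simp
  qed
  with r show "p = q" by (simp add: vec_eq_iff forall_2)
qed

text \<open>Only a half-axis is missed, but discarding the whole horizontal axis leaves a standard
  hyperplane, which is negligible.\<close>

lemma range_polar: "{x. x $ 2 \<noteq> 0} \<subseteq> polar ` polar_domain"
proof
  fix x :: "real^2" assume "x \<in> {x. x $ 2 \<noteq> 0}"
  then have x: "x $ 2 \<noteq> 0" by simp
  then have n: "0 < norm x" by auto
  obtain t where t: "0 \<le> t" "t < 2 * pi" "x $ 1 / norm x = cos t" "x $ 2 / norm x = sin t"
  proof (rule sincos_total_2pi)
    have "(x $ 1 / norm x)\<^sup>2 + (x $ 2 / norm x)\<^sup>2 = (norm x)\<^sup>2 / (norm x)\<^sup>2"
      unfolding power_divide add_divide_distrib[symmetric] by (simp add: norm_vec2)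
    then show "(x $ 1 / norm x)\<^sup>2 + (x $ 2 / norm x)\<^sup>2 = 1"
      using n by simp
  qed auto
  moreover have "t \<noteq> 0" using t x n by auto
  moreover have "polar (vector [norm x, t]) = x"
    using n by (simp add: polar_def vec_eq_iff forall_2 flip: t(3,4))
  ultimately have "vector [norm x, t] \<in> polar_domain" "x = polar (vector [norm x, t])"
    using n t(1,2) by (simp_all add: polar_domain_def)
  then show "x \<in> polar ` polar_domain" by (rule image_eqI[rotated])
qed

lemma nn_integral_polar_vec:
  assumes h [measurable]: "h \<in> borel_measurable borel"
  shows "(\<integral>\<^sup>+x. h x \<partial>lborel) = (\<integral>\<^sup>+p. indicator polar_domain p * (ennreal \<bar>p $ 1\<bar> * h (polar p)) \<partial>lborel)"
proof -
  have "negligible {x :: real^2. x $ 2 = 0}"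
    by (rule negligible_standard_hyperplane_cart)
  then have "negligible (UNIV - polar ` polar_domain)"
    by (rule negligible_subset) (use range_polar in blast)
  then show ?thesis
    by (subst nn_integral_change_of_variables[OF polar_domain_borel measurable_polar polar_has_derivative inj_on_polar])
      (simp_all add: det_polar_derivative)
qed

lemma nn_integral_polar:
  assumes [measurable]: "h \<in> borel_measurable borel"
  shows "(\<integral>\<^sup>+x. h x \<partial>lborel)
    = (\<integral>\<^sup>+t. indicator {0..2*pi} t * (\<integral>\<^sup>+r. indicator {0<..} r * (ennreal r * h (r *\<^sub>R circle_point t)) \<partial>lborel) \<partial>lborel)"
proof -
  have nth: "(\<lambda>p :: real^2. p $ i) \<in> borel_measurable borel" for i
    by (intro borel_measurable_continuous_onI continuous_intros)
  note [measurable] = nth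
  let ?k = "\<lambda>p. indicator polar_domain p * (ennreal \<bar>p $ 1\<bar> * h (polar p))"
  have "(\<integral>\<^sup>+x. h x \<partial>lborel) = (\<integral>\<^sup>+p. ?k p \<partial>distr (lborel \<Otimes>\<^sub>M lborel) borel (\<lambda>(x, y). vector [x, y]))"
    unfolding lborel_eq_distr_vector_prod[symmetric] by (rule nn_integral_polar_vec) simp
  also have "\<dots> = (\<integral>\<^sup>+z. ?k ((\<lambda>(x, y). vector [x, y]) z) \<partial>(lborel \<Otimes>\<^sub>M lborel))"
    by (rule nn_integral_distr[OF measurable_vector_prod]) measurable
  also have "\<dots> = (\<integral>\<^sup>+z. (\<lambda>(r, t). indicator {0<..<2*pi} t * (indicator {0<..} r * (ennreal r * h (r *\<^sub>R circle_point t)))) z \<partial>(lborel \<Otimes>\<^sub>M lborel))"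
    by (intro nn_integral_cong) (auto simp: polar_domain_def indicator_def polar_def)
  also have "\<dots> = (\<integral>\<^sup>+t. (\<integral>\<^sup>+r. indicator {0<..<2*pi} t * (indicator {0<..} r * (ennreal r * h (r *\<^sub>R circle_point t))) \<partial>lborel) \<partial>lborel)"
    by (subst lborel_pair.nn_integral_snd[symmetric]) simp_all
  also have "\<dots> = (\<integral>\<^sup>+t. indicator {0<..<2*pi} t * (\<integral>\<^sup>+r. indicator {0<..} r * (ennreal r * h (r *\<^sub>R circle_point t)) \<partial>lborel) \<partial>lborel)"
    by (intro nn_integral_cong nn_integral_cmult) measurable
  also have "\<dots> = (\<integral>\<^sup>+t. indicator {0..2*pi} t * (\<integral>\<^sup>+r. indicator {0<..} r * (ennreal r * h (r *\<^sub>R circle_point t)) \<partial>lborel) \<partial>lborel)"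
  proof (rule nn_integral_cong_AE)
    show "AE t in lborel. indicator {0<..<2*pi} t * (\<integral>\<^sup>+r. indicator {0<..} r * (ennreal r * h (r *\<^sub>R circle_point t)) \<partial>lborel)
       = indicator {0..2*pi} t * (\<integral>\<^sup>+r. indicator {0<..} r * (ennreal r * h (r *\<^sub>R circle_point t)) \<partial>lborel)"
      using AE_lborel_singleton[of 0] AE_lborel_singleton[of "2*pi"]
      by eventually_elim (auto simp: indicator_def)
  qed
  finally show ?thesis .
qed

section \<open>The variance as an integral over the circle\<close>

lemma spectral_kernel_diag: "spectral_kernel u u \<xi> = of_real (2 * (1 - cos (u \<bullet> \<xi>)))"
proof -
  have e: "exp (\<i> * complex_of_real x) = Complex (cos x) (sin x)" for x
    by (simp add: cis_conv_exp[symmetric] cis.code)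
  have e': "exp (- (\<i> * complex_of_real x)) = Complex (cos x) (- sin x)" for x
    using e[of "-x"] by simp
  show ?thesis
    using sin_cos_squared_add[of "u \<bullet> \<xi>"]
    by (simp add: spectral_kernel_def e e' complex_eq_iff power2_eq_square algebra_simps)
qed

lemma anisotropy_on_circle:
  assumes "anisotropy_function H M Y C"
  shows "(\<lambda>t. C (circle_point t)) \<in> borel_measurable borel" "0 \<le> C (circle_point t)"
proof -
  let ?f = "\<lambda>\<xi>. norm \<xi> powr (- 2 * H - 2) * C (\<xi> /\<^sub>R norm \<xi>)"
  have f: "?f \<in> borel_measurable borel" "\<And>\<xi>. 0 \<le> ?f \<xi>"
    using assms unfolding anisotropy_function_def spectral_density_def by auto
  have eq: "C (circle_point t) = ?f (circle_point t)" for t by simp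
  show "(\<lambda>t. C (circle_point t)) \<in> borel_measurable borel"
    unfolding eq by (rule measurable_compose[OF measurable_circle_point f(1)])
  show "0 \<le> C (circle_point t)" unfolding eq by (rule f(2))
qed

text \<open>An extended nonnegative value, so that the variance formula follows from Tonelli's
  theorem alone; the value infinity is treated as a separate case in
  \<open>structure_tensor_unique\<close>.\<close>

definition radial_mass :: "real \<Rightarrow> ennreal" where
  "radial_mass H = (\<integral>\<^sup>+r. indicator {0<..} r * ennreal (2 * (1 - cos r) * r powr (- 2 * H - 1)) \<partial>lborel)"

text \<open>The cosine transform with exponent 2 H of the angular density \<open>c\<close>.\<close>

definition angular_mass :: "real \<Rightarrow> (real \<Rightarrow> real) \<Rightarrow> real^2 \<Rightarrow> ennreal" where
  "angular_mass H c u = (\<integral>\<^sup>+t. indicator {0..2*pi} t * ennreal (\<bar>u \<bullet> circle_point t\<bar> powr (2 * H) * c t) \<partial>lborel)"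

text \<open>Substituting r |s| for r gives a factor |s| from dr and |s|^(-2H-1) from the power,
  together |s|^(-2H). For s = 0 both sides vanish, as \<open>0 powr a = 0\<close>.\<close>

lemma radial_scaling:
  "(\<integral>\<^sup>+r. indicator {0<..} r * ennreal (2 * (1 - cos (r * s)) * r powr (- 2 * H - 1)) \<partial>lborel)
    = ennreal (\<bar>s\<bar> powr (2 * H)) * radial_mass H"
proof (cases "s = 0")
  case False
  let ?k = "\<lambda>r. ennreal (2 * (1 - cos (r * s)) * r powr (- 2 * H - 1))"
  have scale: "indicator {0<..} (0 + \<bar>s\<bar> * x) *
        ennreal (2 * (1 - cos (0 + \<bar>s\<bar> * x)) * (0 + \<bar>s\<bar> * x) powr (- 2 * H - 1))
      = ennreal (\<bar>s\<bar> powr (- 2 * H - 1)) * (indicator {0<..} x * ?k x)" for x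
  proof -
    have "cos (\<bar>s\<bar> * x) = cos (x * s)" by (cases "0 \<le> s") (simp_all add: mult.commute)
    then show ?thesis
      using False by (cases "0 < x") (simp_all add: powr_mult zero_less_mult_iff ac_simps flip: ennreal_mult')
  qed
  have "radial_mass H = \<bar>s\<bar> * (\<integral>\<^sup>+x. ennreal (\<bar>s\<bar> powr (- 2 * H - 1)) * (indicator {0<..} x * ?k x) \<partial>lborel)"
    unfolding radial_mass_def scale[symmetric]
    by (subst nn_integral_real_affine[where c = "\<bar>s\<bar>" and t = 0]) (use False in simp_all)
  also have "\<dots> = ennreal (\<bar>s\<bar> * \<bar>s\<bar> powr (- 2 * H - 1)) * (\<integral>\<^sup>+x. indicator {0<..} x * ?k x \<partial>lborel)"
    by (subst nn_integral_cmult) (simp_all add: ennreal_mult mult.assoc)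
  also have "\<bar>s\<bar> * \<bar>s\<bar> powr (- 2 * H - 1) = \<bar>s\<bar> powr (- 2 * H)"
    using False by (simp add: powr_diff)
  finally have "ennreal (\<bar>s\<bar> powr (2 * H)) * radial_mass H
    = ennreal (\<bar>s\<bar> powr (2 * H) * \<bar>s\<bar> powr (- 2 * H)) * (\<integral>\<^sup>+x. indicator {0<..} x * ?k x \<partial>lborel)"
    by (simp add: ennreal_mult mult.assoc)
  also have "\<bar>s\<bar> powr (2 * H) * \<bar>s\<bar> powr (- 2 * H) = 1"
    using False by (simp flip: powr_add)
  finally show ?thesis by simp
qed simp

text \<open>On the diagonal the kernel is 2 (1 - cos (u . xi)), so the integrand is nonnegative and
  polar coordinates apply directly. The Jacobian r turns the radial exponent -2H-2 into -2H-1, and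
  \<open>radial_scaling\<close> extracts the dependence on the direction.\<close>

lemma variance_eq_mass:
  assumes "anisotropy_function H M Y C"
  shows "ennreal (LINT \<omega>|M. (Y u \<omega>)\<^sup>2) = radial_mass H * angular_mass H (\<lambda>t. C (circle_point t)) u"
proof -
  let ?f = "\<lambda>\<xi>. norm \<xi> powr (- 2 * H - 2) * C (\<xi> /\<^sub>R norm \<xi>)"
  let ?g = "\<lambda>\<xi>. 2 * (1 - cos (u \<bullet> \<xi>)) * ?f \<xi>"
  have f [measurable]: "?f \<in> borel_measurable borel" and f0: "\<And>\<xi>. 0 \<le> ?f \<xi>"
    and int: "integrable lborel (\<lambda>\<xi>. spectral_kernel u u \<xi> * of_real (?f \<xi>))"
    and E: "complex_of_real (LINT \<omega>|M. Y u \<omega> * Y u \<omega>) = (LINT \<xi>|lborel. spectral_kernel u u \<xi> * of_real (?f \<xi>))"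
    using assms unfolding anisotropy_function_def spectral_density_def by auto
  have k: "spectral_kernel u u \<xi> * of_real (?f \<xi>) = of_real (?g \<xi>)" for \<xi>
    by (simp add: spectral_kernel_diag)
  have int': "integrable lborel ?g"
    using int unfolding k complex_of_real_integrable_eq .
  have E': "(LINT \<omega>|M. (Y u \<omega>)\<^sup>2) = (LINT \<xi>|lborel. ?g \<xi>)"
    using E unfolding k power2_eq_square integral_complex_of_real of_real_eq_iff .
  have "ennreal (LINT \<xi>|lborel. ?g \<xi>) = (\<integral>\<^sup>+\<xi>. ennreal (?g \<xi>) \<partial>lborel)"
    using int' f0 by (intro nn_integral_eq_integral[symmetric]) (auto intro!: AE_I2 mult_nonneg_nonneg)
  also have "\<dots> = (\<integral>\<^sup>+t. indicator {0..2*pi} t * (\<integral>\<^sup>+r. indicator {0<..} r * (ennreal r * ennreal (?g (r *\<^sub>R circle_point t))) \<partial>lborel) \<partial>lborel)"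
    by (rule nn_integral_polar) measurable
  also have "\<dots> = (\<integral>\<^sup>+t. radial_mass H * (indicator {0..2*pi} t * ennreal (\<bar>u \<bullet> circle_point t\<bar> powr (2 * H) * C (circle_point t))) \<partial>lborel)"
  proof (rule nn_integral_cong)
    fix t
    note c0 = anisotropy_on_circle(2)[OF assms, of t]
    have "(\<integral>\<^sup>+r. indicator {0<..} r * (ennreal r * ennreal (?g (r *\<^sub>R circle_point t))) \<partial>lborel)
      = (\<integral>\<^sup>+r. ennreal (C (circle_point t)) * (indicator {0<..} r * ennreal (2 * (1 - cos (r * (u \<bullet> circle_point t))) * r powr (- 2 * H - 1))) \<partial>lborel)"
    proof (rule nn_integral_cong)
      fix r :: real
      have "r * r powr (- 2 * H - 2) = r powr (- 2 * H - 1)" if "0 < r"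
        using that by (simp add: powr_diff power2_eq_square)
      then show "indicator {0<..} r * (ennreal r * ennreal (?g (r *\<^sub>R circle_point t)))
        = ennreal (C (circle_point t)) * (indicator {0<..} r * ennreal (2 * (1 - cos (r * (u \<bullet> circle_point t))) * r powr (- 2 * H - 1)))"
        using c0 by (cases "0 < r") (simp_all add: ac_simps flip: ennreal_mult')
    qed
    also have "\<dots> = ennreal (C (circle_point t)) * (ennreal (\<bar>u \<bullet> circle_point t\<bar> powr (2 * H)) * radial_mass H)"
      unfolding radial_scaling[symmetric] by (rule nn_integral_cmult) measurable
    finally have inner: "(\<integral>\<^sup>+r. indicator {0<..} r * (ennreal r * ennreal (?g (r *\<^sub>R circle_point t))) \<partial>lborel)
      = ennreal (C (circle_point t)) * (ennreal (\<bar>u \<bullet> circle_point t\<bar> powr (2 * H)) * radial_mass H)" .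
    show "indicator {0..2*pi} t * (\<integral>\<^sup>+r. indicator {0<..} r * (ennreal r * ennreal (?g (r *\<^sub>R circle_point t))) \<partial>lborel)
      = radial_mass H * (indicator {0..2*pi} t * ennreal (\<bar>u \<bullet> circle_point t\<bar> powr (2 * H) * C (circle_point t)))"
      unfolding inner using c0 by (cases "t \<in> {0..2*pi}") (simp_all add: ennreal_mult' ac_simps)
  qed
  also have "\<dots> = radial_mass H * angular_mass H (\<lambda>t. C (circle_point t)) u"
    unfolding angular_mass_def using anisotropy_on_circle(1)[OF assms]
    by (intro nn_integral_cmult) measurable
  finally show ?thesis by (simp add: E')
qed

lemma radial_mass_pos: "radial_mass H \<noteq> 0"
proof
  assume "radial_mass H = 0"
  then have "AE r in lborel. indicator {0<..} r * ennreal (2 * (1 - cos r) * r powr (- 2 * H - 1)) = 0"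
    unfolding radial_mass_def by (subst (asm) nn_integral_0_iff_AE) auto
  then have "AE r::real in lborel. r \<notin> {0<..<pi}"
  proof eventually_elim
    case (elim r)
    show ?case
    proof
      assume r: "r \<in> {0<..<pi}"
      then have "cos r < 1" using cos_monotone_0_pi[of 0 r] by simp
      then have "0 < 2 * (1 - cos r) * r powr (- 2 * H - 1)" using r by simp
      with r elim show False by (simp add: ennreal_eq_0_iff)
    qed
  qed
  then have "emeasure lborel {0<..<pi} = 0"
    by (subst (asm) AE_iff_measurable[of "{0<..<pi}"]) auto
  then show False by simp
qed

lemma abs_powr_ge_square:
  fixes x H :: real
  assumes "0 < H" "H < 1" "\<bar>x\<bar> \<le> 1"
  shows "x\<^sup>2 \<le> \<bar>x\<bar> powr (2 * H)"
proof -
  have "\<bar>x\<bar> powr 2 \<le> \<bar>x\<bar> powr (2 * H)"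
    using assms by (intro powr_mono') auto
  then show ?thesis by (cases "x = 0") simp_all
qed

text \<open>As H < 1, |x|^(2H) is at least x^2 on [-1, 1], and cos^2 + sin^2 = 1. Two directions
  therefore control the total mass, which serves both integrability on the circle and nontriviality
  of the elementary field.\<close>

lemma mass_le_angular_mass:
  assumes H: "0 < H" "H < 1" and c [measurable]: "c \<in> borel_measurable borel" and c0: "\<And>t. 0 \<le> c t"
  shows "(\<integral>\<^sup>+t. indicator {0..2*pi} t * ennreal (c t) \<partial>lborel)
    \<le> angular_mass H c (axis 1 1) + angular_mass H c (axis 2 1)"
proof -
  have ax: "axis i 1 \<bullet> circle_point t = circle_point t $ i" for i t
    by (simp add: inner_axis')
  have "c t \<le> \<bar>cos t\<bar> powr (2 * H) * c t + \<bar>sin t\<bar> powr (2 * H) * c t" for t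
  proof -
    have "1 \<le> \<bar>cos t\<bar> powr (2 * H) + \<bar>sin t\<bar> powr (2 * H)"
      using abs_powr_ge_square[OF H abs_cos_le_one, of t] abs_powr_ge_square[OF H abs_sin_le_one, of t]
        sin_cos_squared_add[of t] by linarith
    from mult_right_mono[OF this c0[of t]] show ?thesis by (simp add: distrib_right)
  qed
  then show ?thesis
    unfolding angular_mass_def ax using c0
    by (subst nn_integral_add[symmetric])
      (auto intro!: nn_integral_mono simp: indicator_def simp flip: ennreal_plus)
qed

section \<open>Recovering the structure tensor from the variances\<close>

lemma integral_periodic_shift:
  fixes f :: "real \<Rightarrow> real"
  assumes per: "\<And>x. f (x + p) = f x" and int: "\<And>a b. f integrable_on {a..b}" and "\<bar>a\<bar> \<le> p"
  shows "integral {a..a + p} f = integral {0..p} f"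
proof -
  have sh: "integral {x..y} f = integral {x + p..y + p} f" for x y
    using integral_shift_real_ivl[of "x + p" p "y + p" f] per by simp
  have pos: "integral {a..a + p} f = integral {0..p} f" if "0 \<le> a" "a \<le> p" for a
  proof -
    have "integral {a..a + p} f = integral {a..p} f + integral {p..a + p} f"
      using that by (intro Henstock_Kurzweil_Integration.integral_combine[symmetric] int) auto
    also have "integral {p..a + p} f = integral {0..a} f" using sh[of 0 a] by simp
    also have "integral {a..p} f + integral {0..a} f = integral {0..p} f"
      using Henstock_Kurzweil_Integration.integral_combine[of 0 a p f] that int by simp
    finally show ?thesis .
  qed
  show ?thesis
  proof (cases "0 \<le> a")
    case False
    then show ?thesis using pos[of "a + p"] sh[of a "a + p"] assms(3) by simp
  qed (use pos assms(3) in auto)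
qed

section \<open>Fourier modes of the kernel |cos|^(2H)\<close>

lemma double_angle_periodic: "cos (2 * (x + 2 * pi)) = cos (2 * x)" "sin (2 * (x + 2 * pi)) = sin (2 * x)"
proof -
  have "2 * (x + 2 * pi) = (2 * x + 2 * pi) + 2 * pi" by simp
  then show "cos (2 * (x + 2 * pi)) = cos (2 * x)" "sin (2 * (x + 2 * pi)) = sin (2 * x)"
    by (simp_all only: cos_periodic sin_periodic)
qed

text \<open>Up to normalisation, \<open>cos_mode\<close> and \<open>mean_mode\<close> are the
  Fourier coefficients of orders 2 and 0 of the kernel. Convolution with the kernel multiplies the
  modes by them, so their positivity makes the modes recoverable.\<close>

definition cos_mode :: "real \<Rightarrow> real" where
  "cos_mode H = integral {0..2*pi} (\<lambda>x. \<bar>cos x\<bar> powr (2 * H) * cos (2 * x))"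

definition mean_mode :: "real \<Rightarrow> real" where
  "mean_mode H = integral {0..2*pi} (\<lambda>x. \<bar>cos x\<bar> powr (2 * H))"

lemma continuous_abs_powr [continuous_intros]:
  fixes f :: "'a::topological_space \<Rightarrow> real"
  assumes "0 < H" "continuous_on S f"
  shows "continuous_on S (\<lambda>x. \<bar>f x\<bar> powr (2 * H))"
  using assms by (intro continuous_on_powr') (auto intro: continuous_intros)

lemma continuous_on_UNIV_integrable:
  fixes f :: "real \<Rightarrow> real"
  shows "continuous_on UNIV f \<Longrightarrow> f integrable_on {a..b}"
  by (rule integrable_continuous_real, erule continuous_on_subset) simp

text \<open>The integrand is odd, and periodicity moves the integral to the reflected
  interval.\<close>

lemma sin_mode_0:
  assumes "0 < H"
  shows "integral {0..2*pi} (\<lambda>x. \<bar>cos x\<bar> powr (2 * H) * sin (2 * x)) = 0"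
proof -
  let ?f = "\<lambda>x. \<bar>cos x\<bar> powr (2 * H) * sin (2 * x)"
  have int: "?f integrable_on {a..b}" for a b
    using assms by (intro continuous_on_UNIV_integrable continuous_intros)
  have per: "?f (x + 2 * pi) = ?f x" for x
    by (simp only: double_angle_periodic cos_periodic)
  have "integral {0..2*pi} ?f = integral {- 2 * pi..0} ?f"
    using integral_periodic_shift[of ?f "2 * pi" "- 2 * pi", OF per int] by simp
  also have "\<dots> = integral {0..2*pi} (\<lambda>x. ?f (- x))"
    using Henstock_Kurzweil_Integration.integral_reflect_real[of "2 * pi" 0 ?f] by simp
  also have "\<dots> = - integral {0..2*pi} ?f"
    by simp
  finally show ?thesis by simp
qed

lemma mean_mode_pos:
  assumes "0 < H"
  shows "0 < mean_mode H"
proof -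
  have "integral {0..2*pi} (\<lambda>x. \<bar>cos x\<bar> powr (2 * H)) \<noteq> 0"
  proof
    assume "integral {0..2*pi} (\<lambda>x. \<bar>cos x\<bar> powr (2 * H)) = 0"
    then have "\<forall>x\<in>{0..2*pi}. \<bar>cos x\<bar> powr (2 * H) = 0"
      using assms by (subst (asm) integral_eq_0_iff) (auto intro!: continuous_intros)
    from bspec[OF this, of 0] show False by simp
  qed
  moreover have "0 \<le> integral {0..2*pi} (\<lambda>x. \<bar>cos x\<bar> powr (2 * H))"
    using assms by (intro integral_nonneg continuous_on_UNIV_integrable continuous_intros) auto
  ultimately show ?thesis by (simp add: mean_mode_def)
qed

text \<open>Shifting the integral by \<open>pi / 2\<close> replaces cosine by sine and changes the sign of \<open>cos (2 x)\<close>;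
  the sum of the two forms has a nonnegative integrand.\<close>

lemma cos_mode_pos:
  assumes "0 < H"
  shows "0 < cos_mode H"
proof -
  let ?f = "\<lambda>x. \<bar>cos x\<bar> powr (2 * H) * cos (2 * x)"
  let ?g = "\<lambda>x. (\<bar>cos x\<bar> powr (2 * H) - \<bar>sin x\<bar> powr (2 * H)) * cos (2 * x)"
  have int: "?f integrable_on {a..b}" for a b
    using assms by (intro continuous_on_UNIV_integrable continuous_intros)
  have int': "(\<lambda>x. - (\<bar>sin x\<bar> powr (2 * H) * cos (2 * x))) integrable_on {a..b}" for a b
    using assms by (intro continuous_on_UNIV_integrable continuous_intros)
  have per: "?f (x + 2 * pi) = ?f x" for x
    by (simp only: double_angle_periodic cos_periodic)
  have "cos_mode H = integral {pi / 2..pi / 2 + 2 * pi} ?f"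
    unfolding cos_mode_def by (rule integral_periodic_shift[symmetric, OF per int]) simp
  also have "\<dots> = integral {0..2*pi} (\<lambda>x. ?f (x + pi / 2))"
    using integral_shift_real_ivl[of "pi / 2" "pi / 2" "pi / 2 + 2 * pi" ?f] by simp
  also have "\<dots> = integral {0..2*pi} (\<lambda>x. - (\<bar>sin x\<bar> powr (2 * H) * cos (2 * x)))"
    by (simp add: cos_add distrib_left)
  finally have "2 * cos_mode H = integral {0..2*pi} ?f + integral {0..2*pi} (\<lambda>x. - (\<bar>sin x\<bar> powr (2 * H) * cos (2 * x)))"
    by (simp add: cos_mode_def)
  also have "\<dots> = integral {0..2*pi} ?g"
    by (subst integral_add[OF int int', symmetric]) (simp add: left_diff_distrib)
  finally have eq: "2 * cos_mode H = integral {0..2*pi} ?g" .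
  \<comment> \<open>Both factors have the sign of |cos x| - |sin x|, since cos (2 x) = cos^2 x -
    sin^2 x.\<close>
  have nonneg: "0 \<le> ?g x" for x
  proof -
    have c: "cos (2 * x) = (cos x)\<^sup>2 - (sin x)\<^sup>2" by (rule cos_double)
    show ?thesis
    proof (cases "\<bar>sin x\<bar> \<le> \<bar>cos x\<bar>")
      case True
      then have "\<bar>sin x\<bar> powr (2 * H) \<le> \<bar>cos x\<bar> powr (2 * H)" "(sin x)\<^sup>2 \<le> (cos x)\<^sup>2"
        using assms by (auto intro!: powr_mono2 simp: abs_le_square_iff)
      then show ?thesis unfolding c by (intro mult_nonneg_nonneg) auto
    next
      case False
      then have "\<bar>cos x\<bar> powr (2 * H) \<le> \<bar>sin x\<bar> powr (2 * H)" "(cos x)\<^sup>2 \<le> (sin x)\<^sup>2"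
        using assms by (auto intro!: powr_mono2 simp: abs_le_square_iff[symmetric])
      then show ?thesis unfolding c by (intro mult_nonpos_nonpos) auto
    qed
  qed
  have cont: "continuous_on S ?g" for S
    using assms by (intro continuous_intros)
  have "integral {0..2*pi} ?g \<noteq> 0"
  proof
    assume "integral {0..2*pi} ?g = 0"
    then have "\<forall>x\<in>{0..2*pi}. ?g x = 0"
      using integral_eq_0_iff[of 0 "2*pi" ?g] cont nonneg by auto
    from bspec[OF this, of 0] assms show False by simp
  qed
  moreover have "0 \<le> integral {0..2*pi} ?g"
    using cont nonneg by (intro integral_nonneg continuous_on_UNIV_integrable)
  ultimately show ?thesis using eq by simp
qed

text \<open>Trigonometric polynomials of orders 0 and 2 are preserved by convolution with the even
  kernel: after a shift by \<open>t\<close> and the addition formulas, the terms with sin (2 x)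
  integrate to zero by \<open>sin_mode_0\<close>.\<close>

lemma angular_convolution:
  assumes H: "0 < H" and t: "\<bar>t\<bar> \<le> 2 * pi"
  shows "integral {0..2*pi} (\<lambda>s. \<bar>cos (s - t)\<bar> powr (2 * H) * (a + b * cos (2 * s) + d * sin (2 * s)))
    = a * mean_mode H + cos_mode H * (b * cos (2 * t) + d * sin (2 * t))"
proof -
  let ?w = "\<lambda>x. \<bar>cos x\<bar> powr (2 * H)"
  let ?f = "\<lambda>s. ?w (s - t) * (a + b * cos (2 * s) + d * sin (2 * s))"
  have per: "?f (x + 2 * pi) = ?f x" for x
    using cos_periodic[of "x - t"] by (simp only: double_angle_periodic add_diff_eq diff_add_eq)
  have int: "?f integrable_on {a..b}" for a b
    using assms by (intro continuous_on_UNIV_integrable continuous_intros)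
  have "integral {0..2*pi} ?f = integral {t..t + 2*pi} ?f"
    by (rule integral_periodic_shift[symmetric, OF per int t])
  also have "\<dots> = integral {0..2*pi} (\<lambda>x. ?f (x + t))"
    using integral_shift_real_ivl[of t t "t + 2 * pi" ?f] by simp
  also have "\<dots> = integral {0..2*pi} (\<lambda>x. a * ?w x + ((b * cos (2 * t) + d * sin (2 * t)) * (?w x * cos (2 * x))
      + (d * cos (2 * t) - b * sin (2 * t)) * (?w x * sin (2 * x))))"
    by (intro integral_cong) (simp add: distrib_left cos_add sin_add, simp add: algebra_simps)
  also have "\<dots> = a * mean_mode H + ((b * cos (2 * t) + d * sin (2 * t)) * cos_mode H
      + (d * cos (2 * t) - b * sin (2 * t)) * 0)"
  proof (rule integral_unique, intro has_integral_add has_integral_mult_right)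
    show "(?w has_integral mean_mode H) {0..2*pi}"
      unfolding mean_mode_def using H by (intro integrable_integral continuous_on_UNIV_integrable continuous_intros)
    show "((\<lambda>x. ?w x * cos (2 * x)) has_integral cos_mode H) {0..2*pi}"
      unfolding cos_mode_def using H by (intro integrable_integral continuous_on_UNIV_integrable continuous_intros)
    show "((\<lambda>x. ?w x * sin (2 * x)) has_integral 0) {0..2*pi}"
      by (rule has_integral_eq_rhs[OF integrable_integral sin_mode_0[OF H, symmetric]])
        (use H in \<open>intro continuous_on_UNIV_integrable continuous_intros\<close>)
  qed
  finally show ?thesis by (simp add: mult.commute)
qed

lemma inner_circle_point: "circle_point s \<bullet> circle_point t = cos (s - t)"
  by (simp add: inner_vec_def sum_2 cos_diff)

text \<open>The order of integration over \<open>s\<close> and \<open>t\<close> is exchanged and the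
  inner integral is \<open>angular_convolution\<close>. Nonnegativity of the trigonometric
  polynomial keeps everything within Tonelli's theorem.\<close>

lemma angular_mass_average:
  assumes H: "0 < H" and c [measurable]: "c \<in> borel_measurable borel" and c0: "\<And>t. 0 \<le> c t"
    and nonneg: "\<And>s. 0 \<le> a + b * cos (2 * s) + d * sin (2 * s)"
  shows "(\<integral>\<^sup>+s. indicator {0..2*pi} s * (ennreal (a + b * cos (2 * s) + d * sin (2 * s))
        * angular_mass H c (circle_point s)) \<partial>lborel)
    = (\<integral>\<^sup>+t. indicator {0..2*pi} t * ennreal ((a * mean_mode H + cos_mode H * (b * cos (2 * t) + d * sin (2 * t))) * c t) \<partial>lborel)"
proof -
  let ?\<phi> = "\<lambda>s. a + b * cos (2 * s) + d * sin (2 * s)"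
  let ?I = "indicator {0..2*pi} :: real \<Rightarrow> ennreal"
  let ?k = "\<lambda>s t. ?I s * (ennreal (?\<phi> s) * (?I t * ennreal (\<bar>cos (s - t)\<bar> powr (2 * H) * c t)))"
  have "(\<integral>\<^sup>+s. ?I s * (ennreal (?\<phi> s) * angular_mass H c (circle_point s)) \<partial>lborel)
      = (\<integral>\<^sup>+s. (\<integral>\<^sup>+t. ?k s t \<partial>lborel) \<partial>lborel)"
    unfolding angular_mass_def inner_circle_point by (simp add: nn_integral_cmult)
  also have "\<dots> = (\<integral>\<^sup>+t. (\<integral>\<^sup>+s. ?k s t \<partial>lborel) \<partial>lborel)"
    by (rule lborel_pair.Fubini') measurable
  also have "\<dots> = (\<integral>\<^sup>+t. ?I t * ennreal ((a * mean_mode H + cos_mode H * (b * cos (2 * t) + d * sin (2 * t))) * c t) \<partial>lborel)"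
  proof (rule nn_integral_cong)
    fix t
    let ?w = "\<lambda>s. \<bar>cos (s - t)\<bar> powr (2 * H) * ?\<phi> s"
    show "(\<integral>\<^sup>+s. ?k s t \<partial>lborel)
      = ?I t * ennreal ((a * mean_mode H + cos_mode H * (b * cos (2 * t) + d * sin (2 * t))) * c t)"
    proof (cases "t \<in> {0..2*pi}")
      case True
      have "(?w has_integral (a * mean_mode H + cos_mode H * (b * cos (2 * t) + d * sin (2 * t)))) {0..2*pi}"
        using angular_convolution[OF H, of t a b d] True H
        by (intro has_integral_eq_rhs[OF integrable_integral] continuous_on_UNIV_integrable continuous_intros) auto
      then have "(\<integral>\<^sup>+s. ennreal (indicator {0..2*pi} s * ?w s) \<partial>lborel)
          = ennreal (a * mean_mode H + cos_mode H * (b * cos (2 * t) + d * sin (2 * t)))"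
        using nonneg by (intro nn_integral_has_integral_lebesgue) auto
      moreover have "(\<integral>\<^sup>+s. ?k s t \<partial>lborel) = (\<integral>\<^sup>+s. ennreal (c t) * ennreal (indicator {0..2*pi} s * ?w s) \<partial>lborel)"
        using True nonneg c0 by (intro nn_integral_cong) (simp add: indicator_def ac_simps flip: ennreal_mult)
      ultimately show ?thesis
        using True c0 by (simp add: nn_integral_cmult ennreal_mult'[OF c0] mult.commute)
    qed simp
  qed
  finally show ?thesis .
qed

section \<open>The variances determine the modes and the structure tensor\<close>

lemma set_integrable_mult_bounded:
  fixes c \<phi> :: "real \<Rightarrow> real"
  assumes "set_integrable lborel S c" and [measurable]: "\<phi> \<in> borel_measurable borel" and B: "\<And>t. \<bar>\<phi> t\<bar> \<le> B"
  shows "set_integrable lborel S (\<lambda>t. \<phi> t * c t)"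
  unfolding set_integrable_def
proof (rule Bochner_Integration.integrable_bound)
  show "integrable lborel (\<lambda>t. B * (indicator S t *\<^sub>R c t))"
    using assms(1) unfolding set_integrable_def by simp
  then show "(\<lambda>t. indicator S t *\<^sub>R (\<phi> t * c t)) \<in> borel_measurable lborel"
    using borel_measurable_times[of \<phi> lborel "\<lambda>t. indicator S t *\<^sub>R c t"]
      borel_measurable_integrable[OF assms(1)[unfolded set_integrable_def]]
    by (simp add: mult.left_commute)
  have "\<bar>\<phi> t * c t\<bar> \<le> \<bar>B * c t\<bar>" for t
    using B[of t] unfolding abs_mult by (intro mult_right_mono) auto
  then show "AE t in lborel. norm (indicator S t *\<^sub>R (\<phi> t * c t)) \<le> norm (B * (indicator S t *\<^sub>R c t))"
    by (simp add: indicator_def)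
qed

lemma set_integrable_circle:
  assumes c: "c \<in> borel_measurable borel" and c0: "\<And>t. 0 \<le> c t"
    and fin: "(\<integral>\<^sup>+t. indicator {0..2*pi} t * ennreal (c t) \<partial>lborel) < \<infinity>"
  shows "set_integrable lborel {0..2*pi} c"
  unfolding set_integrable_def
proof (rule integrableI_nonneg)
  have "(\<integral>\<^sup>+t. ennreal (indicator {0..2*pi} t *\<^sub>R c t) \<partial>lborel) = (\<integral>\<^sup>+t. indicator {0..2*pi} t * ennreal (c t) \<partial>lborel)"
    by (intro nn_integral_cong) (simp add: indicator_def)
  then show "(\<integral>\<^sup>+t. ennreal (indicator {0..2*pi} t *\<^sub>R c t) \<partial>lborel) < \<infinity>"
    using fin by simp
qed (use c c0 in auto)

lemma nn_integral_eq_set_integral: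
  fixes f :: "real \<Rightarrow> real"
  assumes "set_integrable lborel {0..2*pi} f" "\<And>t. t \<in> {0..2*pi} \<Longrightarrow> 0 \<le> f t"
  shows "(\<integral>\<^sup>+t. indicator {0..2*pi} t * ennreal (f t) \<partial>lborel) = ennreal (LINT t:{0..2*pi}|lborel. f t)"
proof -
  have "(\<integral>\<^sup>+t. indicator {0..2*pi} t * ennreal (f t) \<partial>lborel) = (\<integral>\<^sup>+t. ennreal (indicator {0..2*pi} t *\<^sub>R f t) \<partial>lborel)"
    by (intro nn_integral_cong) (simp add: indicator_def)
  also have "\<dots> = ennreal (LINT t:{0..2*pi}|lborel. f t)"
    unfolding set_lebesgue_integral_def using assms
    by (intro nn_integral_eq_integral) (auto simp: set_integrable_def indicator_def)
  finally show ?thesis .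
qed

lemma fourier_modes_unique:
  assumes H: "0 < H"
    and c: "c \<in> borel_measurable borel" "\<And>t. 0 \<le> c t" "set_integrable lborel {0..2*pi} c"
    and c': "c' \<in> borel_measurable borel" "\<And>t. 0 \<le> c' t" "set_integrable lborel {0..2*pi} c'"
    and eq: "\<And>u. angular_mass H c u = angular_mass H c' u"
  shows "(LINT t:{0..2*pi}|lborel. c t) = (LINT t:{0..2*pi}|lborel. c' t)"
    and "(LINT t:{0..2*pi}|lborel. cos (2 * t) * c t) = (LINT t:{0..2*pi}|lborel. cos (2 * t) * c' t)"
    and "(LINT t:{0..2*pi}|lborel. sin (2 * t) * c t) = (LINT t:{0..2*pi}|lborel. sin (2 * t) * c' t)"
proof -
  have *: "a * mean_mode H * (LINT t:{0..2*pi}|lborel. c t)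
      + cos_mode H * (b * (LINT t:{0..2*pi}|lborel. cos (2 * t) * c t) + d * (LINT t:{0..2*pi}|lborel. sin (2 * t) * c t))
    = a * mean_mode H * (LINT t:{0..2*pi}|lborel. c' t)
      + cos_mode H * (b * (LINT t:{0..2*pi}|lborel. cos (2 * t) * c' t) + d * (LINT t:{0..2*pi}|lborel. sin (2 * t) * c' t))"
    if \<phi>: "\<And>s. 0 \<le> a + b * cos (2 * s) + d * sin (2 * s)" for a b d
  proof -
    let ?m = "\<lambda>t. a * mean_mode H + cos_mode H * (b * cos (2 * t) + d * sin (2 * t))"
    let ?w = "\<lambda>t s. \<bar>cos (s - t)\<bar> powr (2 * H) * (a + b * cos (2 * s) + d * sin (2 * s))"
    \<comment> \<open>The multiplier is a convolution of two nonnegative functions.\<close>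
    have m0: "0 \<le> ?m t" if "t \<in> {0..2*pi}" for t
    proof -
      have "0 \<le> integral {0..2*pi} (?w t)"
        using H \<phi> by (intro integral_nonneg continuous_on_UNIV_integrable continuous_intros) auto
      then show ?thesis using angular_convolution[OF H, of t a b d] that by simp
    qed
    have val: "(\<integral>\<^sup>+t. indicator {0..2*pi} t * ennreal (?m t * g t) \<partial>lborel)
        = ennreal (a * mean_mode H * (LINT t:{0..2*pi}|lborel. g t)
      + cos_mode H * (b * (LINT t:{0..2*pi}|lborel. cos (2 * t) * g t) + d * (LINT t:{0..2*pi}|lborel. sin (2 * t) * g t)))"
      "0 \<le> a * mean_mode H * (LINT t:{0..2*pi}|lborel. g t)
      + cos_mode H * (b * (LINT t:{0..2*pi}|lborel. cos (2 * t) * g t) + d * (LINT t:{0..2*pi}|lborel. sin (2 * t) * g t))"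
      if g: "\<And>t. 0 \<le> g t" "set_integrable lborel {0..2*pi} g" for g
    proof -
      have ic: "set_integrable lborel {0..2*pi} (\<lambda>t. cos (2 * t) * g t)"
        by (rule set_integrable_mult_bounded[OF g(2), where B = 1]) simp_all
      have isn: "set_integrable lborel {0..2*pi} (\<lambda>t. sin (2 * t) * g t)"
        by (rule set_integrable_mult_bounded[OF g(2), where B = 1]) simp_all
      have e: "?m t * g t = a * mean_mode H * g t + cos_mode H * (b * (cos (2 * t) * g t) + d * (sin (2 * t) * g t))" for t
        by (simp add: algebra_simps)
      have i: "set_integrable lborel {0..2*pi} (\<lambda>t. ?m t * g t)"
        unfolding e by (intro set_integral_add set_integrable_mult_right g(2) ic isn)
      have v: "(LINT t:{0..2*pi}|lborel. ?m t * g t) = a * mean_mode H * (LINT t:{0..2*pi}|lborel. g t)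
        + cos_mode H * (b * (LINT t:{0..2*pi}|lborel. cos (2 * t) * g t) + d * (LINT t:{0..2*pi}|lborel. sin (2 * t) * g t))"
        unfolding e using g(2) ic isn
        by (simp add: set_integral_add set_integrable_mult_right)
      show "(\<integral>\<^sup>+t. indicator {0..2*pi} t * ennreal (?m t * g t) \<partial>lborel)
        = ennreal (a * mean_mode H * (LINT t:{0..2*pi}|lborel. g t)
      + cos_mode H * (b * (LINT t:{0..2*pi}|lborel. cos (2 * t) * g t) + d * (LINT t:{0..2*pi}|lborel. sin (2 * t) * g t)))"
        unfolding v[symmetric] using m0 g by (intro nn_integral_eq_set_integral i) auto
      show "0 \<le> a * mean_mode H * (LINT t:{0..2*pi}|lborel. g t)
      + cos_mode H * (b * (LINT t:{0..2*pi}|lborel. cos (2 * t) * g t) + d * (LINT t:{0..2*pi}|lborel. sin (2 * t) * g t))"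
        unfolding v[symmetric] unfolding set_lebesgue_integral_def using m0 g
        by (intro integral_nonneg_AE AE_I2) (auto simp: indicator_def)
    qed
    have "(\<integral>\<^sup>+t. indicator {0..2*pi} t * ennreal (?m t * c t) \<partial>lborel)
        = (\<integral>\<^sup>+t. indicator {0..2*pi} t * ennreal (?m t * c' t) \<partial>lborel)"
      unfolding angular_mass_average[OF H c(1,2) \<phi>, symmetric] angular_mass_average[OF H c'(1,2) \<phi>, symmetric] eq ..
    then show ?thesis
      unfolding val(1)[OF c(2,3)] val(1)[OF c'(2,3)] ennreal_inj[OF val(2)[OF c(2,3)] val(2)[OF c'(2,3)]] .
  qed
  \<comment> \<open>The test functions must be nonnegative, so 1 is added to cosine and sine; its
    contribution cancels by the equality of the means.\<close>
  have c1: "0 \<le> 1 + cos (2 * s)" and s1: "0 \<le> 1 + sin (2 * s)" for s :: real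
    using cos_ge_minus_one[of "2 * s"] sin_ge_minus_one[of "2 * s"] by linarith+
  show 1: "(LINT t:{0..2*pi}|lborel. c t) = (LINT t:{0..2*pi}|lborel. c' t)"
    using *[of 1 0 0] mean_mode_pos[OF H] by simp
  show "(LINT t:{0..2*pi}|lborel. cos (2 * t) * c t) = (LINT t:{0..2*pi}|lborel. cos (2 * t) * c' t)"
    using *[of 1 1 0] c1 1 cos_mode_pos[OF H] by simp
  show "(LINT t:{0..2*pi}|lborel. sin (2 * t) * c t) = (LINT t:{0..2*pi}|lborel. sin (2 * t) * c' t)"
    using *[of 1 0 1] s1 1 cos_mode_pos[OF H] by simp
qed

text \<open>By the double angle formulas the products of coordinates on the circle are (1 + cos (2
  t)) / 2, (1 - cos (2 t)) / 2 and sin (2 t) / 2, so three modes of \<open>C\<close> fix all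
  entries.\<close>

lemma structure_tensor_eqI:
  assumes i: "set_integrable lborel {0..2*pi} (\<lambda>t. C (circle_point t))"
    and i': "set_integrable lborel {0..2*pi} (\<lambda>t. C' (circle_point t))"
    and 1: "(LINT t:{0..2*pi}|lborel. C (circle_point t)) = (LINT t:{0..2*pi}|lborel. C' (circle_point t))"
    and 2: "(LINT t:{0..2*pi}|lborel. cos (2 * t) * C (circle_point t)) = (LINT t:{0..2*pi}|lborel. cos (2 * t) * C' (circle_point t))"
    and 3: "(LINT t:{0..2*pi}|lborel. sin (2 * t) * C (circle_point t)) = (LINT t:{0..2*pi}|lborel. sin (2 * t) * C' (circle_point t))"
  shows "structure_tensor C = structure_tensor C'"
proof -
  have ic: "set_integrable lborel {0..2*pi} (\<lambda>t. cos (2 * t) * c t)"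
    and isn: "set_integrable lborel {0..2*pi} (\<lambda>t. sin (2 * t) * c t)"
    if "set_integrable lborel {0..2*pi} c" for c
    by (rule set_integrable_mult_bounded[OF that, where B = 1]; simp)+
  have c2: "cos (2 * t) = 2 * (cos t * cos t) - 1" "cos (2 * t) = 1 - 2 * (sin t * sin t)" for t :: real
    unfolding power2_eq_square[symmetric] by (rule cos_double_cos, rule cos_double_sin)
  have cc: "cos t * cos t * x = (x + cos (2 * t) * x) / 2" for t x :: real
    unfolding c2(1) by (simp add: algebra_simps)
  have ss: "sin t * sin t * x = (x - cos (2 * t) * x) / 2" for t x :: real
    unfolding c2(2) by (simp add: algebra_simps)
  have sc: "sin t * cos t * x = (sin (2 * t) * x) / 2" "cos t * sin t * x = (sin (2 * t) * x) / 2" for t x :: real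
    by (simp_all add: sin_double)
  show ?thesis
    unfolding structure_tensor_def vec_eq_iff forall_2
    using i i' ic[OF i] ic[OF i'] isn[OF i] isn[OF i'] 1 2 3
    by (simp add: cc ss sc set_integral_add set_integral_diff)
qed

lemma angular_mass_finite:
  assumes "anisotropy_function H M Y C"
  shows "angular_mass H (\<lambda>t. C (circle_point t)) u < \<infinity>"
proof -
  have "radial_mass H * angular_mass H (\<lambda>t. C (circle_point t)) u < \<infinity>"
    unfolding variance_eq_mass[OF assms, symmetric] by simp
  then show ?thesis using radial_mass_pos[of H] by (auto simp: ennreal_mult_less_top)
qed

text \<open>The definition of an anisotropy function only gives integrability against the spectral
  kernel; finiteness of the variances at the two basis vectors gives it on the circle.\<close>

lemma anisotropy_integrable:
  assumes H: "0 < H" "H < 1" and "anisotropy_function H M Y C"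
  shows "set_integrable lborel {0..2*pi} (\<lambda>t. C (circle_point t))"
proof (intro set_integrable_circle anisotropy_on_circle[OF assms(3)])
  show "(\<integral>\<^sup>+t. indicator {0..2*pi} t * ennreal (C (circle_point t)) \<partial>lborel) < \<infinity>"
    using angular_mass_finite[OF assms(3)]
    by (intro le_less_trans[OF mass_le_angular_mass[OF H anisotropy_on_circle[OF assms(3)]]])
      (simp add: ennreal_add_less_top)
qed

lemma structure_tensor_unique:
  assumes H: "0 < H" "H < 1" and C: "anisotropy_function H M Y C" and C': "anisotropy_function H N Y' C'"
    and var: "\<And>u. (LINT \<omega>|M. (Y u \<omega>)\<^sup>2) = (LINT \<omega>|N. (Y' u \<omega>)\<^sup>2)"
  shows "structure_tensor C = structure_tensor C'"
proof -
  have "angular_mass H (\<lambda>t. C (circle_point t)) u = angular_mass H (\<lambda>t. C' (circle_point t)) u" for u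
  proof -
    have eq: "radial_mass H * angular_mass H (\<lambda>t. C (circle_point t)) u
        = radial_mass H * angular_mass H (\<lambda>t. C' (circle_point t)) u"
      unfolding variance_eq_mass[OF C, symmetric] variance_eq_mass[OF C', symmetric] var ..
    have "radial_mass H * angular_mass H (\<lambda>t. C (circle_point t)) u \<noteq> \<infinity>"
      unfolding variance_eq_mass[OF C, symmetric] by simp
    \<comment> \<open>If \<open>radial_mass H\<close> is infinite, finiteness of the variance forces
      both angular masses to be zero; otherwise it is finite and nonzero and cancels.\<close>
    with eq radial_mass_pos[of H] show ?thesis
      by (cases "radial_mass H = \<infinity>") (auto simp: ennreal_mult_eq_top_iff ennreal_mult_cancel_left)
  qed
  note modes = fourier_modes_unique[OF H(1) anisotropy_on_circle[OF C] anisotropy_integrable[OF H C]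
      anisotropy_on_circle[OF C'] anisotropy_integrable[OF H C'] this]
  show ?thesis
    by (rule structure_tensor_eqI[OF anisotropy_integrable[OF H C] anisotropy_integrable[OF H C'] modes])
qed

section \<open>Tangent fields of warped fields\<close>

text \<open>Division by the standard deviation leads to the real part of the standard normal
  characteristic function; in the degenerate case both sides are 1.\<close>

lemma centered_gaussian_cos:
  assumes "prob_space M" "centered_gaussian M V" and [measurable]: "V \<in> borel_measurable M"
  shows "(LINT \<omega>|M. cos (V \<omega>)) = exp (- (LINT \<omega>|M. (V \<omega>)\<^sup>2) / 2)"
proof -
  interpret prob_space M by fact
  show ?thesis
    using assms(2) unfolding centered_gaussian_def
  proof (elim disjE exE conjE)
    assume "AE \<omega> in M. V \<omega> = 0"
    then have *: "AE \<omega> in M. cos (V \<omega>) = 1" "AE \<omega> in M. (V \<omega>)\<^sup>2 = 0" by auto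
    have "(LINT \<omega>|M. cos (V \<omega>)) = 1"
      using integral_cong_AE[OF _ _ *(1)] by (simp add: prob_space)
    moreover have "(LINT \<omega>|M. (V \<omega>)\<^sup>2) = 0"
      using integral_eq_zero_AE[OF *(2)] .
    ultimately show ?thesis by simp
  next
    fix \<sigma> :: real assume \<sigma>: "0 < \<sigma>" and "distributed M lborel V (normal_density 0 \<sigma>)"
    then have S: "distributed M lborel (\<lambda>\<omega>. V \<omega> / \<sigma>) std_normal_density"
      using normal_standard_normal_convert[OF \<sigma>, of V 0] by simp
    have sq: "(LINT x|lborel. std_normal_density x * x\<^sup>2) = 1"
      using std_normal_distribution_even_moments(1)[of 1]
      by (subst (asm) integral_density) (auto simp: fact_numeral)
    have iexp: "integrable std_normal_distribution (\<lambda>x. iexp (\<sigma> * x))"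
      by (rule prob_space.integrable_iexp[OF prob_space_normal_density]) auto
    have "(LINT x|std_normal_distribution. cos (\<sigma> * x)) = Re (char std_normal_distribution \<sigma>)"
      unfolding char_def by (subst integral_Re[OF iexp, symmetric]) (simp add: Re_exp)
    also have "\<dots> = exp (- \<sigma>\<^sup>2 / 2)"
      unfolding char_std_normal_distribution by (rule Re_complex_of_real)
    also have "(LINT x|std_normal_distribution. cos (\<sigma> * x)) = (LINT x|lborel. std_normal_density x * cos (\<sigma> * x))"
      by (subst integral_density) (auto simp: normal_density_nonneg)
    finally have c: "(LINT x|lborel. std_normal_density x * cos (\<sigma> * x)) = exp (- \<sigma>\<^sup>2 / 2)" .
    have "(LINT \<omega>|M. cos (\<sigma> * (V \<omega> / \<sigma>))) = exp (- \<sigma>\<^sup>2 / 2)"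
      by (rule trans[OF distributed_integral[OF S, symmetric] c]) auto
    moreover have "(LINT \<omega>|M. (V \<omega> / \<sigma>)\<^sup>2) = 1"
      by (rule trans[OF distributed_integral[OF S, symmetric] sq]) auto
    ultimately show ?thesis
      using \<sigma> by (simp add: power_divide)
  qed
qed

lemma gaussian_field_centered_gaussian: "gaussian_field M Y \<Longrightarrow> centered_gaussian M (Y u)"
  unfolding gaussian_field_def
  by (elim conjE allE[of _ "{u}"] allE[of _ "\<lambda>_. 1"]) simp

lemma gaussian_field_cos:
  assumes "gaussian_field M Y"
  shows "(LINT \<omega>|M. cos (Y u \<omega>)) = exp (- (LINT \<omega>|M. (Y u \<omega>)\<^sup>2) / 2)"
  using assms by (intro centered_gaussian_cos gaussian_field_centered_gaussian)
    (auto simp: gaussian_field_def random_field_def)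

text \<open>The square is unbounded and hence no admissible test functional, but cos (f u) is one,
  and its expectation exp (- v / 2) is injective in the variance v.\<close>

lemma tangent_variance_unique:
  assumes "localizable_at H M Z x0 N Y" "gaussian_field N Y"
    and "localizable_at H M Z x0 N' Y'" "gaussian_field N' Y'"
  shows "(LINT \<omega>|N. (Y u \<omega>)\<^sup>2) = (LINT \<omega>|N'. (Y' u \<omega>)\<^sup>2)"
proof -
  let ?F = "\<lambda>f :: real^2 \<Rightarrow> real. cos (f u)"
  have F: "continuous_functional ?F"
    unfolding continuous_functional_def
  proof (intro allI impI)
    fix fs :: "nat \<Rightarrow> real^2 \<Rightarrow> real" and f assume "\<forall>K. compact K \<longrightarrow> uniform_limit K fs f sequentially"
    from this[rule_format, of "{u}"] have "(\<lambda>n. fs n u) \<longlonglongrightarrow> f u" by simp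
    then show "(\<lambda>n. ?F (fs n)) \<longlonglongrightarrow> ?F f" by (rule tendsto_cos)
  qed
  have B: "\<exists>B. \<forall>g. \<bar>?F g\<bar> \<le> B" by (rule exI[of _ 1]) simp
  let ?V = "\<lambda>\<rho>. LINT \<omega>|M. ?F (\<lambda>u. \<rho> powr (- H) * (Z (x0 + \<rho> *\<^sub>R u) \<omega> - Z x0 \<omega>))"
  have lim: "(?V \<longlongrightarrow> (LINT \<omega>|N. cos (Y u \<omega>))) (at_right 0)"
    using assms(1) F B unfolding localizable_at_def field_converges_in_distribution_def by blast
  have lim': "(?V \<longlongrightarrow> (LINT \<omega>|N'. cos (Y' u \<omega>))) (at_right 0)"
    using assms(3) F B unfolding localizable_at_def field_converges_in_distribution_def by blast
  have "(LINT \<omega>|N. cos (Y u \<omega>)) = (LINT \<omega>|N'. cos (Y' u \<omega>))"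
    by (rule tendsto_unique[OF trivial_limit_at_right_real lim lim'])
  then show ?thesis
    unfolding gaussian_field_cos[OF assms(2)] gaussian_field_cos[OF assms(4)] by simp
qed

lemma random_field_compose:
  assumes "random_field M X" "continuous_on UNIV g"
  shows "random_field M (\<lambda>u. X (g u))"
proof -
  have "continuous_on UNIV (\<lambda>u. X (g u) \<omega>)" if "\<omega> \<in> space M" for \<omega>
    using assms that unfolding random_field_def
    by (intro continuous_on_compose2[of UNIV "\<lambda>x. X x \<omega>" UNIV g]) auto
  then show ?thesis using assms by (simp add: random_field_def)
qed

lemma random_field_increment:
  assumes "random_field M X"
  shows "random_field M (\<lambda>u \<omega>. c * (X u \<omega> - X y \<omega>))"
  using assms unfolding random_field_def
  by (auto intro!: continuous_intros borel_measurable_times borel_measurable_diff)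

text \<open>The kernel vanishes at (0, 0), so the second moment of \<open>X 0\<close> is zero, which
  excludes the nondegenerate Gaussian law. This removes the term \<open>X 0\<close> left over by the
  increment identities.\<close>

lemma anisotropy_function_origin:
  assumes "anisotropy_function H M X C"
  shows "AE \<omega> in M. X 0 \<omega> = 0"
proof -
  have g: "gaussian_field M X" and E: "complex_of_real (LINT \<omega>|M. X 0 \<omega> * X 0 \<omega>) = 0"
    using assms by (auto simp: anisotropy_function_def spectral_density_def spectral_kernel_def)
  interpret prob_space M using g by (simp add: gaussian_field_def random_field_def)
  have E0: "(LINT \<omega>|M. (X 0 \<omega>)\<^sup>2) = 0"
    using E by (simp add: power2_eq_square)
  from gaussian_field_centered_gaussian[OF g, of 0] show ?thesis
    unfolding centered_gaussian_def
  proof (elim disjE exE conjE)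
    fix \<sigma> :: real assume \<sigma>: "0 < \<sigma>" "distributed M lborel (X 0) (normal_density 0 \<sigma>)"
    have "(LINT \<omega>|M. (X 0 \<omega>)\<^sup>2) = \<sigma>\<^sup>2"
      using normal_distributed_variance[OF \<sigma>] normal_distributed_expectation[OF \<sigma>] by simp
    with E0 \<sigma>(1) show ?thesis by simp
  qed
qed

section \<open>Passage to the tangent field\<close>

lemma difference_quotient_uniform_limit:
  fixes \<Phi> :: "real^2 \<Rightarrow> real^2"
  assumes der: "(\<Phi> has_derivative g) (at x0)" and K: "compact K"
    and pos: "\<And>n. 0 < S n" and lim: "S \<longlonglongrightarrow> 0"
  shows "uniform_limit K (\<lambda>n u. (\<Phi> (x0 + S n *\<^sub>R u) - \<Phi> x0) /\<^sub>R S n) g sequentially"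
proof (rule uniform_limitI)
  fix e :: real assume e: "0 < e"
  obtain R where R: "0 < R" "\<And>u. u \<in> K \<Longrightarrow> norm u \<le> R"
    using compact_imp_bounded[OF K] by (auto simp: bounded_pos)
  interpret g: bounded_linear g using der by (rule has_derivative_bounded_linear)
  \<comment> \<open>On \<open>K\<close> the increment has norm at most S n * R, so the slope e / (2
    R) leaves an error e / 2 after division by S n.\<close>
  obtain d where d: "0 < d" "\<And>y. norm (y - x0) < d \<Longrightarrow> norm (\<Phi> y - \<Phi> x0 - g (y - x0)) \<le> e / (2 * R) * norm (y - x0)"
    using has_derivative_at_alt[THEN iffD1, OF der, THEN conjunct2, rule_format, of "e / (2 * R)"] e R(1) by auto
  have "\<forall>\<^sub>F n in sequentially. S n < d / R"
    using lim d(1) R(1) by (intro order_tendstoD) auto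
  then show "\<forall>\<^sub>F n in sequentially. \<forall>u\<in>K. dist ((\<Phi> (x0 + S n *\<^sub>R u) - \<Phi> x0) /\<^sub>R S n) (g u) < e"
  proof eventually_elim
    case (elim n)
    show ?case
    proof
      fix u assume u: "u \<in> K"
      note S = pos[of n]
      have le: "S n * norm u \<le> S n * R" using R(2)[OF u] S by simp
      also have "\<dots> < d" using elim R(1) by (simp add: pos_less_divide_eq)
      finally have "norm (\<Phi> (x0 + S n *\<^sub>R u) - \<Phi> x0 - g (S n *\<^sub>R u)) \<le> e / (2 * R) * (S n * norm u)"
        using d(2)[of "x0 + S n *\<^sub>R u"] S by simp
      also have "\<dots> \<le> e / (2 * R) * (S n * R)"
        by (rule mult_left_mono[OF le]) (use e R(1) in simp)
      also have "\<dots> = S n * (e / 2)" using R(1) by simp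
      finally have "norm (\<Phi> (x0 + S n *\<^sub>R u) - \<Phi> x0 - S n *\<^sub>R g u) \<le> S n * (e / 2)"
        by (simp add: g.scaleR)
      then have "inverse (S n) * norm (\<Phi> (x0 + S n *\<^sub>R u) - \<Phi> x0 - S n *\<^sub>R g u) \<le> inverse (S n) * (S n * (e / 2))"
        by (rule mult_left_mono) (use S in simp)
      also have "\<dots> = e / 2" using S by simp
      finally have "inverse (S n) * norm (\<Phi> (x0 + S n *\<^sub>R u) - \<Phi> x0 - S n *\<^sub>R g u) \<le> e / 2" .
      moreover have "(\<Phi> (x0 + S n *\<^sub>R u) - \<Phi> x0) /\<^sub>R S n - g u = (\<Phi> (x0 + S n *\<^sub>R u) - \<Phi> x0 - S n *\<^sub>R g u) /\<^sub>R S n"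
        using S by (simp add: scaleR_diff_right)
      ultimately have "dist ((\<Phi> (x0 + S n *\<^sub>R u) - \<Phi> x0) /\<^sub>R S n) (g u) \<le> e / 2"
        using S by (simp only: dist_norm norm_scaleR) simp
      then show "dist ((\<Phi> (x0 + S n *\<^sub>R u) - \<Phi> x0) /\<^sub>R S n) (g u) < e" using e by simp
    qed
  qed
qed

lemma uniform_limit_continuous_compose:
  fixes \<phi> :: "real^2 \<Rightarrow> real"
  assumes u: "uniform_limit K f l F" and \<phi>: "continuous_on UNIV \<phi>" and b: "bounded (l ` K)"
  shows "uniform_limit K (\<lambda>n x. \<phi> (f n x)) (\<lambda>x. \<phi> (l x)) F"
proof -
  obtain R where R: "\<And>x. x \<in> K \<Longrightarrow> norm (l x) \<le> R" using b by (auto simp: bounded_iff)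
  have "uniformly_continuous_on (cball 0 (R + 1)) \<phi>"
    by (intro compact_uniformly_continuous continuous_on_subset[OF \<phi>]) auto
  moreover have "\<forall>\<^sub>F n in F. \<forall>x\<in>K. dist (f n x) (l x) < 1"
    using u by (rule uniform_limitD) simp
  then have "\<forall>\<^sub>F n in F. \<forall>x\<in>K. f n x \<in> cball 0 (R + 1)"
  proof eventually_elim
    case (elim n)
    have "norm (f n x) \<le> R + 1" if "x \<in> K" for x
      using elim that R[OF that] norm_triangle_ineq2[of "f n x" "l x"] by (force simp: dist_norm)
    then show ?case by auto
  qed
  ultimately show ?thesis
    using uniform_limit_compose_uniformly_continuous_on[OF u, of "cball 0 (R + 1)" \<phi>] by simp
qed

text \<open>Stationarity moves the base point \<open>h\<close> to the origin, then self-similarity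
  cancels the scaling. The map \<open>g\<close> is arbitrary because an equality of laws of whole
  fields survives any reparametrisation; it will be a nonlinear difference quotient that varies with
  the scale.\<close>

lemma scaled_increment_law:
  fixes g :: "real^2 \<Rightarrow> real^2"
  assumes X: "random_field M X" and ss: "self_similar H M X" and si: "stationary_increments M X" and \<rho>: "0 < \<rho>"
  shows "field_law M (\<lambda>u \<omega>. \<rho> powr (- H) * (X (h + \<rho> *\<^sub>R g u) \<omega> - X h \<omega>))
    = field_law M (\<lambda>u \<omega>. X (g u) \<omega> - X 0 \<omega>)"
proof -
  have m: "X x \<in> borel_measurable M" for x using X by (simp add: random_field_def)
  have "field_law M (\<lambda>u \<omega>. \<rho> powr (- H) * (X (\<rho> *\<^sub>R g u + h) \<omega> - X h \<omega>))
      = field_law M (\<lambda>u \<omega>. \<rho> powr (- H) * (X (\<rho> *\<^sub>R g u) \<omega> - X 0 \<omega>))"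
    using si[unfolded stationary_increments_def, rule_format, of h]
    by (rule field_law_transform[where T = "\<lambda>f u. \<rho> powr (- H) * f (\<rho> *\<^sub>R g u)"])
      (use m in \<open>auto intro!: borel_measurable_diff borel_measurable_times measurable_component_singleton\<close>)
  also have "\<dots> = field_law M (\<lambda>u \<omega>. \<rho> powr (- H) * (\<rho> powr H * X (g u) \<omega> - \<rho> powr H * X 0 \<omega>))"
    using field_law_transform[where T = "\<lambda>f u. \<rho> powr (- H) * (f (g u) - f 0)",
        OF ss[unfolded self_similar_def, rule_format, OF \<rho>]] m
    by (auto intro!: borel_measurable_diff borel_measurable_times measurable_component_singleton)
  also have "(\<lambda>u \<omega>. \<rho> powr (- H) * (\<rho> powr H * X (g u) \<omega> - \<rho> powr H * X 0 \<omega>)) = (\<lambda>u \<omega>. X (g u) \<omega> - X 0 \<omega>)"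
    using \<rho> by (simp add: right_diff_distrib mult.assoc[symmetric] powr_add[symmetric])
  finally show ?thesis by (simp add: add.commute)
qed

text \<open>Along a sequence of scales, each expectation is rewritten by equality of laws as one of
  a field built from \<open>X\<close> on the same space. There the paths converge locally uniformly
  at every sample point, and boundedness of \<open>F\<close> gives dominated convergence.\<close>

lemma warped_localizable:
  assumes C: "anisotropy_function H M X C" and cont: "continuous_on UNIV \<Phi>"
    and der: "(\<Phi> has_derivative g) (at x0)"
    and nontrivial: "\<not> (\<forall>u. AE \<omega> in M. X (g u) \<omega> = 0)"
  shows "localizable_at H M (warped_field \<Phi> X) x0 M (\<lambda>u. X (g u))"
proof -
  have X: "random_field M X" and ss: "self_similar H M X" and si: "stationary_increments M X"
    using C by (auto simp: anisotropy_function_def gaussian_field_def)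
  interpret prob_space M using X by (simp add: random_field_def)
  have g: "continuous_on S g" for S
    using has_derivative_bounded_linear[OF der] by (rule linear_continuous_on)
  have Y: "random_field M (\<lambda>u. X (g u))" by (rule random_field_compose[OF X g])
  have Z: "random_field M (warped_field \<Phi> X)"
    using random_field_compose[OF X cont] by (simp add: warped_field_def[abs_def])
  let ?V = "\<lambda>\<rho> u \<omega>. \<rho> powr (- H) * (warped_field \<Phi> X (x0 + \<rho> *\<^sub>R u) \<omega> - warped_field \<Phi> X x0 \<omega>)"
  have "((\<lambda>\<rho>. LINT \<omega>|M. F (\<lambda>u. ?V \<rho> u \<omega>)) \<longlongrightarrow> (LINT \<omega>|M. F (\<lambda>u. X (g u) \<omega>))) (at_right 0)"
    if F: "continuous_functional F" and B: "\<And>f. \<bar>F f\<bar> \<le> B" for F B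
  proof (rule tendsto_at_right_sequentially[of 0 1])
    fix S :: "nat \<Rightarrow> real" assume pos: "\<And>n. 0 < S n" and lim: "S \<longlonglongrightarrow> 0"
    define G where "G n u = (\<Phi> (x0 + S n *\<^sub>R u) - \<Phi> x0) /\<^sub>R S n" for n u
    have cG: "continuous_on UNIV (G n)" for n
      unfolding G_def by (intro continuous_intros continuous_on_compose2[OF cont]) auto
    have rfi: "random_field M (\<lambda>u \<omega>. X (f u) \<omega> - X 0 \<omega>)" if "continuous_on UNIV f" for f
      using random_field_compose[OF random_field_increment[OF X, of 1 0] that] by simp
    have V: "random_field M (?V (S n))" for n
    proof -
      have "continuous_on UNIV (\<lambda>u. x0 + S n *\<^sub>R u)" by (intro continuous_intros)
      from random_field_compose[OF random_field_increment[OF Z] this] show ?thesis by simp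
    qed
    have eq: "(LINT \<omega>|M. F (\<lambda>u. ?V (S n) u \<omega>)) = (LINT \<omega>|M. F (\<lambda>u. X (G n u) \<omega> - X 0 \<omega>))" for n
    proof (rule expectation_eq_of_law_eq[OF F B V rfi[OF cG]])
      have "\<Phi> (x0 + S n *\<^sub>R u) = \<Phi> x0 + S n *\<^sub>R G n u" for u
        using pos[of n] by (simp add: G_def)
      then show "field_law M (?V (S n)) = field_law M (\<lambda>u \<omega>. X (G n u) \<omega> - X 0 \<omega>)"
        unfolding warped_field_def by (simp add: scaled_increment_law[OF X ss si pos])
    qed
    have "(LINT \<omega>|M. F (\<lambda>u. X (g u) \<omega> - X 0 \<omega>)) = (LINT \<omega>|M. F (\<lambda>u. X (g u) \<omega>))"
      using anisotropy_function_origin[OF C]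
      by (intro integral_cong_AE measurable_continuous_functional[OF F] rfi g Y) auto
    moreover have "(\<lambda>n. LINT \<omega>|M. F (\<lambda>u. X (G n u) \<omega> - X 0 \<omega>)) \<longlonglongrightarrow> (LINT \<omega>|M. F (\<lambda>u. X (g u) \<omega> - X 0 \<omega>))"
    proof (rule integral_dominated_convergence)
      show "integrable M (\<lambda>\<omega>. B)" by simp
      show "AE \<omega> in M. norm (F (\<lambda>u. X (G n u) \<omega> - X 0 \<omega>)) \<le> B" for n using B by simp
      show "AE \<omega> in M. (\<lambda>n. F (\<lambda>u. X (G n u) \<omega> - X 0 \<omega>)) \<longlonglongrightarrow> F (\<lambda>u. X (g u) \<omega> - X 0 \<omega>)"
      proof (rule AE_I2, rule continuous_functionalD[OF F])
        fix \<omega> assume \<omega>: "\<omega> \<in> space M"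
        show "continuous_on UNIV (\<lambda>u. X (G n u) \<omega> - X 0 \<omega>)" for n
          using rfi[OF cG, of n] \<omega> by (simp add: random_field_def)
        show "continuous_on UNIV (\<lambda>u. X (g u) \<omega> - X 0 \<omega>)"
          using rfi[OF g] \<omega> by (simp add: random_field_def)
        fix K :: "(real^2) set" assume K: "compact K"
        have "uniform_limit K G g sequentially"
          unfolding G_def[abs_def] by (rule difference_quotient_uniform_limit[OF der K pos lim])
        then show "uniform_limit K (\<lambda>n u. X (G n u) \<omega> - X 0 \<omega>) (\<lambda>u. X (g u) \<omega> - X 0 \<omega>) sequentially"
          using X \<omega> compact_imp_bounded[OF compact_continuous_image[OF g K]]
          by (intro uniform_limit_minus uniform_limit_const uniform_limit_continuous_compose[where l = g])
            (auto simp: random_field_def)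
      qed
    qed (intro measurable_continuous_functional[OF F] rfi g cG)+
    ultimately show "(\<lambda>n. LINT \<omega>|M. F (\<lambda>u. ?V (S n) u \<omega>)) \<longlonglongrightarrow> (LINT \<omega>|M. F (\<lambda>u. X (g u) \<omega>))"
      unfolding eq by simp
  qed simp
  then show ?thesis
    using Y Z nontrivial unfolding localizable_at_def field_converges_in_distribution_def by blast
qed

section \<open>Linear images of a field and their spectral densities\<close>

text \<open>The spectral kernel is complex valued, so substitution is needed for Bochner integrals;
  these follow from an identity of measures.\<close>

lemma lborel_eq_distr_linear:
  fixes B :: "real^'n::{finite,wellorder}^'n::_"
  assumes "invertible B"
  shows "lborel = distr (density lborel (\<lambda>_. ennreal \<bar>det B\<bar>)) borel ((*v) B)"
proof (rule measure_eqI)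
  have m: "(\<lambda>x. B *v x) \<in> borel_measurable borel"
    by (intro borel_measurable_continuous_onI matrix_vector_mult_linear_continuous_on)
  fix S :: "(real^'n::_) set" assume "S \<in> sets lborel"
  then have S: "S \<in> sets borel" by simp
  have vS: "(*v) B -` S \<in> sets borel"
    using measurable_sets_borel[OF m S] .
  have "emeasure lborel S = (\<integral>\<^sup>+x. indicator S x \<partial>lborel)"
    using S by simp
  also have "\<dots> = ennreal \<bar>det B\<bar> * (\<integral>\<^sup>+x. indicator S (B *v x) \<partial>lborel)"
    by (rule nn_integral_linear_change_of_variables[OF assms]) (use S in simp)
  also have "(\<lambda>x. indicator S (B *v x) :: ennreal) = indicator ((*v) B -` S)"
    by (auto simp: indicator_def fun_eq_iff)
  finally show "emeasure lborel S = emeasure (distr (density lborel (\<lambda>_. ennreal \<bar>det B\<bar>)) borel ((*v) B)) S"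
    using S vS m by (simp add: emeasure_distr emeasure_density_const)
qed simp

lemma linear_change_of_variables:
  fixes B :: "real^'n::{finite,wellorder}^'n::_" and h :: "real^'n::_ \<Rightarrow> 'b::{banach, second_countable_topology}"
  assumes B: "invertible B" and h: "integrable lborel h"
  shows "integrable lborel (\<lambda>x. \<bar>det B\<bar> *\<^sub>R h (B *v x))"
    and "(LINT x|lborel. \<bar>det B\<bar> *\<^sub>R h (B *v x)) = (LINT x|lborel. h x)"
proof -
  have m: "(\<lambda>x. B *v x) \<in> borel_measurable borel"
    by (intro borel_measurable_continuous_onI matrix_vector_mult_linear_continuous_on)
  have hm: "h \<in> borel_measurable borel"
    using borel_measurable_integrable[OF h] by simp
  have hB: "(\<lambda>x. h (B *v x)) \<in> borel_measurable borel"
    by (rule measurable_compose[OF m hm])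
  let ?D = "density lborel (\<lambda>_::real^'n::_. ennreal \<bar>det B\<bar>)"
  have "integrable (distr ?D borel ((*v) B)) h"
    using h unfolding lborel_eq_distr_linear[OF B, symmetric] .
  then show "integrable lborel (\<lambda>x. \<bar>det B\<bar> *\<^sub>R h (B *v x))"
    using m hm hB by (simp add: integrable_distr_eq integrable_density)
  have "(LINT x|lborel. h x) = (LINT x|distr ?D borel ((*v) B). h x)"
    unfolding lborel_eq_distr_linear[OF B, symmetric] ..
  also have "\<dots> = (LINT x|lborel. \<bar>det B\<bar> *\<^sub>R h (B *v x))"
    using m hm hB by (simp add: integral_distr integral_density)
  finally show "(LINT x|lborel. \<bar>det B\<bar> *\<^sub>R h (B *v x)) = (LINT x|lborel. h x)" ..
qed

text \<open>The anisotropy function of \<open>u \<mapsto> X (A u)\<close>, where \<open>B\<close> is the inverse transpose of \<open>A\<close>.\<close>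

definition pullback_anisotropy :: "real \<Rightarrow> real^2^2 \<Rightarrow> (real^2 \<Rightarrow> real) \<Rightarrow> real^2 \<Rightarrow> real" where
  "pullback_anisotropy H B C \<Theta> =
     \<bar>det B\<bar> * (norm (B *v \<Theta>) powr (- 2 * H - 2) * C ((B *v \<Theta>) /\<^sub>R norm (B *v \<Theta>)))"

text \<open>The density is homogeneous of degree -2H-2, so its composition with \<open>B\<close>
  again has the required radial form. At the origin both sides vanish because
  \<open>0 powr a = 0\<close>.\<close>

lemma pullback_anisotropy_density:
  "norm \<eta> powr (- 2 * H - 2) * pullback_anisotropy H B C (\<eta> /\<^sub>R norm \<eta>)
    = \<bar>det B\<bar> * (norm (B *v \<eta>) powr (- 2 * H - 2) * C ((B *v \<eta>) /\<^sub>R norm (B *v \<eta>)))"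
proof (cases "\<eta> = 0")
  case False
  let ?n = "norm \<eta>"
  have n: "0 < ?n" using False by simp
  have Bn: "B *v (\<eta> /\<^sub>R ?n) = (B *v \<eta>) /\<^sub>R ?n"
    by (simp add: matrix_vector_mult_scaleR)
  have e1: "?n powr (- 2 * H - 2) * (norm (B *v \<eta>) / ?n) powr (- 2 * H - 2) = norm (B *v \<eta>) powr (- 2 * H - 2)"
    using n by (subst powr_mult[symmetric]) simp_all
  have e2: "((B *v \<eta>) /\<^sub>R ?n) /\<^sub>R (norm (B *v \<eta>) / ?n) = (B *v \<eta>) /\<^sub>R norm (B *v \<eta>)"
    using n by (simp add: inverse_eq_divide)
  have e3: "norm ((B *v \<eta>) /\<^sub>R ?n) = norm (B *v \<eta>) / ?n"
    using n by (simp add: divide_inverse mult.commute)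
  show ?thesis
    unfolding pullback_anisotropy_def Bn e3 e2 e1[symmetric] by (simp only: ac_simps)
qed simp

lemma spectral_kernel_transform:
  assumes "transpose A ** B = mat 1"
  shows "spectral_kernel (A *v u) (A *v v) (B *v \<xi>) = spectral_kernel u v \<xi>"
proof -
  have "(A *v x) \<bullet> (B *v \<xi>) = x \<bullet> \<xi>" for x
  proof -
    have "(A *v x) \<bullet> (B *v \<xi>) = (x v* transpose A) \<bullet> (B *v \<xi>)" by (simp only: vector_transpose_matrix)
    also have "\<dots> = x \<bullet> \<xi>"
      unfolding dot_lmul_matrix matrix_vector_mul_assoc assms by simp
    finally show ?thesis .
  qed
  then show ?thesis by (simp add: spectral_kernel_def)
qed

lemma anisotropy_function_linear:
  assumes X: "anisotropy_function H M X C" and A: "invertible A" and AB: "transpose A ** B = mat 1"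
  shows "anisotropy_function H M (\<lambda>u. X (A *v u)) (pullback_anisotropy H B C)"
  unfolding anisotropy_function_def
proof (intro conjI)
  have B: "invertible B"
    unfolding invertible_left_inverse using AB by (rule exI)
  have G: "gaussian_field M X" and rf: "random_field M X" and ss: "self_similar H M X" and si: "stationary_increments M X"
    using X by (auto simp: anisotropy_function_def gaussian_field_def)
  have m: "X x \<in> borel_measurable M" for x using rf by (simp add: random_field_def)
  have inj: "inj ((*v) A)" using A by (rule inj_matrix_vector_mult)
  show "gaussian_field M (\<lambda>u. X (A *v u))"
    unfolding gaussian_field_def
  proof (intro conjI allI impI)
    show "random_field M (\<lambda>u. X (A *v u))"
      by (rule random_field_compose[OF rf matrix_vector_mult_linear_continuous_on])
    fix S :: "(real^2) set" and a assume "finite S"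
    \<comment> \<open>Distinct points have distinct images under \<open>A\<close>, so a linear
      combination of the new field is one of \<open>X\<close>, with coefficients carried over by the
      inverse.\<close>
    have "(\<Sum>x\<in>S. a x * X (A *v x) \<omega>) = (\<Sum>y\<in>(*v) A ` S. a (inv ((*v) A) y) * X y \<omega>)" for \<omega>
      using inj by (subst sum.reindex) (auto intro: inj_on_subset)
    then show "centered_gaussian M (\<lambda>\<omega>. \<Sum>x\<in>S. a x * X (A *v x) \<omega>)"
      using G \<open>finite S\<close> by (simp add: gaussian_field_def)
  qed
  show "self_similar H M (\<lambda>u. X (A *v u))"
    unfolding self_similar_def
  proof (intro allI impI)
    fix \<rho> :: real assume "0 < \<rho>"
    from field_law_transform[where T = "\<lambda>f u. f (A *v u)", OF ss[unfolded self_similar_def, rule_format, OF this]]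
    show "field_law M (\<lambda>x. X (A *v (\<rho> *\<^sub>R x))) = field_law M (\<lambda>x \<omega>. \<rho> powr H * X (A *v x) \<omega>)"
      using m by (simp add: matrix_vector_mult_scaleR)
  qed
  show "stationary_increments M (\<lambda>u. X (A *v u))"
    unfolding stationary_increments_def
  proof
    fix h
    from field_law_transform[where T = "\<lambda>f u. f (A *v u)", OF si[unfolded stationary_increments_def, rule_format, of "A *v h"]]
    show "field_law M (\<lambda>x \<omega>. X (A *v (x + h)) \<omega> - X (A *v h) \<omega>) = field_law M (\<lambda>x \<omega>. X (A *v x) \<omega> - X (A *v 0) \<omega>)"
      using m by (simp add: matrix_vector_right_distrib)
  qed
  let ?f = "\<lambda>\<xi>. norm \<xi> powr (- 2 * H - 2) * C (\<xi> /\<^sub>R norm \<xi>)"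
  have f: "?f \<in> borel_measurable borel" "\<And>\<xi>. 0 \<le> ?f \<xi>"
    and int: "\<And>x y. integrable lborel (\<lambda>\<xi>. spectral_kernel x y \<xi> * of_real (?f \<xi>))"
    and E: "\<And>x y. complex_of_real (LINT \<omega>|M. X x \<omega> * X y \<omega>) = (LINT \<xi>|lborel. spectral_kernel x y \<xi> * of_real (?f \<xi>))"
    using X unfolding anisotropy_function_def spectral_density_def by auto
  have mB: "(\<lambda>x. B *v x) \<in> borel_measurable borel"
    by (intro borel_measurable_continuous_onI matrix_vector_mult_linear_continuous_on)
  have k: "spectral_kernel x y \<xi> * of_real (\<bar>det B\<bar> * ?f (B *v \<xi>))
      = \<bar>det B\<bar> *\<^sub>R (spectral_kernel (A *v x) (A *v y) (B *v \<xi>) * of_real (?f (B *v \<xi>)))" for x y \<xi>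
    unfolding spectral_kernel_transform[OF AB] by (simp add: scaleR_conv_of_real)
  show "spectral_density M (\<lambda>u. X (A *v u)) (\<lambda>\<xi>. norm \<xi> powr (- 2 * H - 2) * pullback_anisotropy H B C (\<xi> /\<^sub>R norm \<xi>))"
    unfolding spectral_density_def pullback_anisotropy_density
  proof (intro conjI allI)
    show "(\<lambda>\<xi>. \<bar>det B\<bar> * ?f (B *v \<xi>)) \<in> borel_measurable borel"
      using measurable_compose[OF mB f(1)] by simp
    show "0 \<le> \<bar>det B\<bar> * ?f (B *v \<xi>)" for \<xi>
      by (rule mult_nonneg_nonneg[OF abs_ge_zero f(2)])
    fix x y
    show "integrable lborel (\<lambda>\<xi>. spectral_kernel x y \<xi> * of_real (\<bar>det B\<bar> * ?f (B *v \<xi>)))"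
      unfolding k by (rule linear_change_of_variables(1)[OF B int])
    show "complex_of_real (LINT \<omega>|M. X (A *v x) \<omega> * X (A *v y) \<omega>)
        = (LINT \<xi>|lborel. spectral_kernel x y \<xi> * of_real (\<bar>det B\<bar> * ?f (B *v \<xi>)))"
      unfolding k linear_change_of_variables(2)[OF B int] by (rule E)
  qed
qed

section \<open>The structure tensor of the tangent field\<close>

lemma measurable_matrix_vector_mult [measurable]:
  "(\<lambda>x. (B :: real^'n^'m) *v x) \<in> borel_measurable borel"
  by (intro borel_measurable_continuous_onI matrix_vector_mult_linear_continuous_on)

text \<open>Scale invariance of the measure dr / r.\<close>

lemma nn_integral_inverse_scaling:
  assumes s: "0 < s"
  shows "(\<integral>\<^sup>+r. indicator {1<..<2} (r * s) * (indicator {0<..} r * ennreal (1 / r)) \<partial>lborel)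
    = (\<integral>\<^sup>+r. indicator {1<..<2} r * ennreal (1 / r) \<partial>lborel)"
proof -
  have "(\<integral>\<^sup>+r. indicator {1<..<2} r * ennreal (1 / r) \<partial>lborel)
      = s * (\<integral>\<^sup>+r. indicator {1<..<2} (0 + s * r) * ennreal (1 / (0 + s * r)) \<partial>lborel)"
    using s by (subst nn_integral_real_affine[where c = s and t = 0]) simp_all
  also have "\<dots> = (\<integral>\<^sup>+r. ennreal s * (indicator {1<..<2} (0 + s * r) * ennreal (1 / (0 + s * r))) \<partial>lborel)"
    by (simp add: nn_integral_cmult)
  also have "\<dots> = (\<integral>\<^sup>+r. indicator {1<..<2} (r * s) * (indicator {0<..} r * ennreal (1 / r)) \<partial>lborel)"
  proof (rule nn_integral_cong)
    fix r
    show "ennreal s * (indicator {1<..<2} (0 + s * r) * ennreal (1 / (0 + s * r)))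
      = indicator {1<..<2} (r * s) * (indicator {0<..} r * ennreal (1 / r))"
    proof (cases "0 < r")
      case True
      then have "ennreal s * ennreal (1 / (s * r)) = ennreal (1 / r)"
        using s by (simp flip: ennreal_mult')
      from this[symmetric] show ?thesis using True by (simp add: ac_simps)
    next
      case False
      then have "s * r \<le> 0" using s by (simp add: mult_nonneg_nonpos)
      then show ?thesis using False by (simp add: indicator_def mult.commute)
    qed
  qed
  finally show ?thesis by simp
qed

lemma invertible_mat_1: "invertible (mat 1 :: 'a::semiring_1^'n^'n)"
  unfolding invertible_def by (rule exI[of _ "mat 1"]) simp

text \<open>Both sides, multiplied by the radial integral of \<open>1 / r\<close> over \<open>{1<..<2}\<close>, are integrals of \<open>F\<close> over
  the annulus \<open>1 < \<parallel>x\<parallel> < 2\<close>, in polar coordinates of \<open>x\<close> and of the preimage of \<open>x\<close> under \<open>T\<close>.\<close>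

lemma circle_integral_homogeneous:
  fixes F :: "real^2 \<Rightarrow> real"
  assumes F [measurable]: "F \<in> borel_measurable borel" and F0: "\<And>x. 0 \<le> F x"
    and hom: "\<And>r x. 0 < r \<Longrightarrow> F (r *\<^sub>R x) = F x / r\<^sup>2" and T: "invertible T"
  shows "(\<integral>\<^sup>+t. indicator {0..2*pi} t * ennreal (F (circle_point t)) \<partial>lborel)
    = ennreal \<bar>det T\<bar> * (\<integral>\<^sup>+t. indicator {0..2*pi} t * ennreal (F (T *v circle_point t)) \<partial>lborel)"
proof -
  let ?L = "\<integral>\<^sup>+r. indicator {1<..<2} r * ennreal (1 / r) \<partial>lborel"
  let ?A = "indicator {1<..<2} :: real \<Rightarrow> ennreal"
  have polar: "(\<integral>\<^sup>+x. ?A (norm (S *v x)) * ennreal (F (S *v x)) \<partial>lborel)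
      = ?L * (\<integral>\<^sup>+t. indicator {0..2*pi} t * ennreal (F (S *v circle_point t)) \<partial>lborel)" if S: "invertible S" for S
  proof -
    have "(\<integral>\<^sup>+x. ?A (norm (S *v x)) * ennreal (F (S *v x)) \<partial>lborel)
      = (\<integral>\<^sup>+t. indicator {0..2*pi} t * (\<integral>\<^sup>+r. indicator {0<..} r * (ennreal r * (?A (norm (S *v (r *\<^sub>R circle_point t))) * ennreal (F (S *v (r *\<^sub>R circle_point t))))) \<partial>lborel) \<partial>lborel)"
      by (rule nn_integral_polar) measurable
    also have "\<dots> = (\<integral>\<^sup>+t. ?L * (indicator {0..2*pi} t * ennreal (F (S *v circle_point t))) \<partial>lborel)"
    proof (rule nn_integral_cong)
      fix t
      let ?s = "norm (S *v circle_point t)"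
      have "S *v circle_point t \<noteq> 0"
        using inj_matrix_vector_mult[OF S] norm_circle_point[of t]
        by (metis injD matrix_vector_mult_0_right norm_zero zero_neq_one)
      then have s: "0 < ?s" by simp
      have "(\<integral>\<^sup>+r. indicator {0<..} r * (ennreal r * (?A (norm (S *v (r *\<^sub>R circle_point t))) * ennreal (F (S *v (r *\<^sub>R circle_point t))))) \<partial>lborel)
        = (\<integral>\<^sup>+r. ennreal (F (S *v circle_point t)) * (?A (r * ?s) * (indicator {0<..} r * ennreal (1 / r))) \<partial>lborel)"
      proof (rule nn_integral_cong)
        fix r :: real
        show "indicator {0<..} r * (ennreal r * (?A (norm (S *v (r *\<^sub>R circle_point t))) * ennreal (F (S *v (r *\<^sub>R circle_point t)))))
          = ennreal (F (S *v circle_point t)) * (?A (r * ?s) * (indicator {0<..} r * ennreal (1 / r)))"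
        proof (cases "0 < r")
          case True
          then have "ennreal r * ennreal (F (S *v circle_point t) / r\<^sup>2) = ennreal (F (S *v circle_point t)) * ennreal (1 / r)"
            using F0[of "S *v circle_point t"] by (simp add: power2_eq_square flip: ennreal_mult)
          then show ?thesis
            using True by (simp add: matrix_vector_mult_scaleR hom ac_simps) (simp add: ac_simps flip: mult.assoc)
        qed simp
      qed
      also have "\<dots> = ennreal (F (S *v circle_point t)) * ?L"
        unfolding nn_integral_inverse_scaling[OF s, symmetric] by (rule nn_integral_cmult) measurable
      finally have inner: "(\<integral>\<^sup>+r. indicator {0<..} r * (ennreal r * (?A (norm (S *v (r *\<^sub>R circle_point t))) * ennreal (F (S *v (r *\<^sub>R circle_point t))))) \<partial>lborel)
        = ennreal (F (S *v circle_point t)) * ?L" .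
      show "indicator {0..2*pi} t * (\<integral>\<^sup>+r. indicator {0<..} r * (ennreal r * (?A (norm (S *v (r *\<^sub>R circle_point t))) * ennreal (F (S *v (r *\<^sub>R circle_point t))))) \<partial>lborel)
        = ?L * (indicator {0..2*pi} t * ennreal (F (S *v circle_point t)))"
        unfolding inner by (simp only: ac_simps)
    qed
    also have "\<dots> = ?L * (\<integral>\<^sup>+t. indicator {0..2*pi} t * ennreal (F (S *v circle_point t)) \<partial>lborel)"
      by (rule nn_integral_cmult) measurable
    finally show ?thesis .
  qed
  have "?L * (\<integral>\<^sup>+t. indicator {0..2*pi} t * ennreal (F (circle_point t)) \<partial>lborel)
      = (\<integral>\<^sup>+x. ?A (norm x) * ennreal (F x) \<partial>lborel)"
    using polar[of "mat 1"] by (simp add: invertible_mat_1)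
  also have "\<dots> = ennreal \<bar>det T\<bar> * (\<integral>\<^sup>+x. ?A (norm (T *v x)) * ennreal (F (T *v x)) \<partial>lborel)"
    by (rule nn_integral_linear_change_of_variables[OF T]) measurable
  also have "\<dots> = ?L * (ennreal \<bar>det T\<bar> * (\<integral>\<^sup>+t. indicator {0..2*pi} t * ennreal (F (T *v circle_point t)) \<partial>lborel))"
    unfolding polar[OF T] by (simp only: ac_simps)
  finally have eq: "?L * (\<integral>\<^sup>+t. indicator {0..2*pi} t * ennreal (F (circle_point t)) \<partial>lborel) = \<dots>" .
  \<comment> \<open>Cancelling \<open>?L\<close> requires it to be finite and nonzero; on the
    interval 1 / r lies between 1 / 2 and 1.\<close>
  have "?L \<le> (\<integral>\<^sup>+r. indicator {1<..<2} (r::real) \<partial>lborel)"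
    by (intro nn_integral_mono) (auto simp: indicator_def)
  then have "?L \<noteq> \<infinity>" by (auto simp: top_unique)
  moreover have "ennreal (1 / 2) * (\<integral>\<^sup>+r. indicator {1<..<2} (r::real) \<partial>lborel) \<le> ?L"
  proof (subst nn_integral_cmult[symmetric], simp, rule nn_integral_mono)
    fix r :: real
    show "ennreal (1 / 2) * indicator {1<..<2} r \<le> indicator {1<..<2} r * ennreal (1 / r)"
    proof (cases "r \<in> {1<..<2}")
      case True
      then have "ennreal (1 / 2) \<le> ennreal (1 / r)" by (intro ennreal_leI) (simp add: field_simps)
      with True show ?thesis by (simp only: indicator_simps mult_1_left mult_1_right)
    qed simp
  qed
  then have "?L \<noteq> 0" by auto
  ultimately show ?thesis using eq by (simp add: ennreal_mult_cancel_left)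
qed

section \<open>The elementary anisotropy function in the angle\<close>

text \<open>\<open>Arg\<close> selects one branch of the angle; the integer \<open>k\<close> absorbs
  its difference from \<open>t\<close>.\<close>

lemma arg_within_circle_point:
  "arg_within (circle_point t) a b \<longleftrightarrow> (\<exists>k::int. t + 2 * pi * of_int k \<in> {a..b})"
proof -
  let ?z = "Complex (cos t) (sin t)"
  have z: "cis t = ?z" by (simp add: cis.code)
  have "cis (Arg ?z) = ?z"
    using cis_Arg[of ?z] z[symmetric] by (simp add: sgn_div_norm)
  then have "sin (Arg ?z) = sin t \<and> cos (Arg ?z) = cos t"
    by (simp add: complex_eq_iff)
  then obtain n :: int where n: "Arg ?z = t + 2 * pi * n"
    unfolding sin_cos_eq_iff by blast
  show ?thesis
    unfolding arg_within_def circle_point_nth n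
  proof
    assume "\<exists>k::int. t + 2 * pi * n + 2 * pi * of_int k \<in> {a..b}"
    then obtain k :: int where "t + 2 * pi * n + 2 * pi * of_int k \<in> {a..b}" ..
    then show "\<exists>k::int. t + 2 * pi * of_int k \<in> {a..b}"
      by (intro exI[of _ "n + k"]) (simp add: distrib_left)
  next
    assume "\<exists>k::int. t + 2 * pi * of_int k \<in> {a..b}"
    then obtain k :: int where "t + 2 * pi * of_int k \<in> {a..b}" ..
    then show "\<exists>k::int. t + 2 * pi * n + 2 * pi * of_int k \<in> {a..b}"
      by (intro exI[of _ "k - n"]) (simp add: right_diff_distrib)
  qed
qed

text \<open>The window is one full period, placed so that both arcs lie inside it. The distance of
  \<open>t\<close> from either centre plus \<delta> stays below 2 pi, so only k = 0 can
  occur.\<close>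

lemma elementary_anisotropy_local:
  assumes \<delta>: "0 < \<delta>" "\<delta> < pi / 2" and t: "t \<in> {\<alpha> - pi / 2..\<alpha> + 3 * pi / 2}"
  shows "elementary_anisotropy \<alpha> \<delta> (circle_point t)
    = 1 / (4 * \<delta>) * (of_bool (t \<in> {\<alpha> - \<delta>..\<alpha> + \<delta>}) + of_bool (t \<in> {\<alpha> + pi - \<delta>..\<alpha> + pi + \<delta>}))"
proof -
  have one: "(\<exists>k::int. t + 2 * pi * of_int k \<in> {b - \<delta>..b + \<delta>}) \<longleftrightarrow> t \<in> {b - \<delta>..b + \<delta>}"
    if b: "\<bar>t - b\<bar> \<le> 3 * pi / 2" for b
  proof
    assume "\<exists>k::int. t + 2 * pi * of_int k \<in> {b - \<delta>..b + \<delta>}"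
    then obtain k :: int where k: "t + 2 * pi * of_int k \<in> {b - \<delta>..b + \<delta>}" ..
    then have "2 * pi * of_int k < 2 * pi * 1" "2 * pi * (- 1) < 2 * pi * of_int k"
      using \<delta> b unfolding atLeastAtMost_iff by linarith+
    then have "k = 0"
      unfolding mult_less_cancel_left_pos[OF pi_gt_zero[THEN mult_pos_pos[OF zero_less_numeral]]] by linarith
    with k show "t \<in> {b - \<delta>..b + \<delta>}" by simp
  qed (auto intro: exI[of _ 0])
  have "\<bar>t - \<alpha>\<bar> \<le> 3 * pi / 2" "\<bar>t - (\<alpha> + pi)\<bar> \<le> 3 * pi / 2"
    using t pi_gt_zero unfolding atLeastAtMost_iff by linarith+
  then show ?thesis
    unfolding elementary_anisotropy_def arg_within_circle_point by (simp only: one)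
qed

lemma elementary_anisotropy_bounds:
  assumes "0 < \<delta>"
  shows "\<bar>elementary_anisotropy \<alpha> \<delta> \<Theta>\<bar> \<le> 1 / (2 * \<delta>)"
  using assms by (simp add: elementary_anisotropy_def field_simps)

lemma circle_point_periodic: "circle_point (t + 2 * pi) = circle_point t" "circle_point (t + pi) = - circle_point t"
  by (simp_all add: vec_eq_iff forall_2)

text \<open>The integral is shifted to the window of \<open>elementary_anisotropy_local\<close>. As
  \<open>G\<close> has period pi, the two arcs contribute equally, which turns 1 / (4 \<delta>) into
  1 / (2 \<delta>).\<close>

lemma elementary_average:
  assumes \<delta>: "0 < \<delta>" "\<delta> < pi / 2" and \<alpha>: "- pi / 2 < \<alpha>" "\<alpha> < pi / 2"
    and G: "continuous_on UNIV G" and per: "\<And>t. G (t + pi) = G t"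
    and m: "(\<lambda>t. elementary_anisotropy \<alpha> \<delta> (circle_point t)) \<in> borel_measurable borel"
  shows "(LINT t:{0..2*pi}|lborel. G t * elementary_anisotropy \<alpha> \<delta> (circle_point t))
    = 1 / (2 * \<delta>) * integral {\<alpha> - \<delta>..\<alpha> + \<delta>} G"
proof -
  let ?h = "\<lambda>t. G t * elementary_anisotropy \<alpha> \<delta> (circle_point t)"
  have si: "set_integrable lborel {a..b} ?h" for a b
    unfolding mult.commute[of "G _"]
    by (rule set_integrable_mult_bounded[OF borel_integrable_atLeastAtMost' m elementary_anisotropy_bounds[OF \<delta>(1)]])
      (rule continuous_on_subset[OF G subset_UNIV])
  have int: "?h integrable_on {a..b}" for a b
    using set_borel_integral_eq_integral(1)[OF si] .
  have per2: "?h (t + 2 * pi) = ?h t" for t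
    using per[of t] per[of "t + pi"] by (simp add: circle_point_periodic add.assoc)
  have "(LINT t:{0..2*pi}|lborel. ?h t) = integral {0..2*pi} ?h"
    by (rule set_borel_integral_eq_integral(2)[OF si])
  also have "\<dots> = integral {\<alpha> - pi / 2..\<alpha> - pi / 2 + 2 * pi} ?h"
    by (rule integral_periodic_shift[symmetric, OF per2 int]) (use \<alpha> in linarith)
  also have "\<dots> = integral {\<alpha> - pi / 2..\<alpha> + 3 * pi / 2} (\<lambda>t. 1 / (4 * \<delta>) *
      ((if t \<in> {\<alpha> - \<delta>..\<alpha> + \<delta>} then G t else 0) + (if t \<in> {\<alpha> + pi - \<delta>..\<alpha> + pi + \<delta>} then G t else 0)))"
  proof -
    have "\<alpha> - pi / 2 + 2 * pi = \<alpha> + 3 * pi / 2" by simp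
    then show ?thesis
      by (simp only:) (intro Henstock_Kurzweil_Integration.integral_cong, auto simp: elementary_anisotropy_local[OF \<delta>])
  qed
  also have "\<dots> = 1 / (4 * \<delta>) * (integral {\<alpha> - \<delta>..\<alpha> + \<delta>} G + integral {\<alpha> + pi - \<delta>..\<alpha> + pi + \<delta>} G)"
  proof -
    have r: "((\<lambda>t. if t \<in> {b - \<delta>..b + \<delta>} then G t else 0) has_integral integral {b - \<delta>..b + \<delta>} G) {\<alpha> - pi / 2..\<alpha> + 3 * pi / 2}"
      if "{b - \<delta>..b + \<delta>} \<subseteq> {\<alpha> - pi / 2..\<alpha> + 3 * pi / 2}" for b
      unfolding has_integral_restrict[OF that]
      by (intro integrable_integral continuous_on_UNIV_integrable G)
    show ?thesis
      by (intro integral_unique has_integral_mult_right has_integral_add r) (use \<delta> in auto)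
  qed
  also have "integral {\<alpha> + pi - \<delta>..\<alpha> + pi + \<delta>} G = integral {\<alpha> - \<delta>..\<alpha> + \<delta>} G"
    using integral_shift_real_ivl[of "\<alpha> + pi - \<delta>" pi "\<alpha> + pi + \<delta>" G] per by (simp add: algebra_simps)
  finally show ?thesis using \<delta> by simp
qed

definition tensor_weight :: "real \<Rightarrow> real^2^2 \<Rightarrow> 2 \<Rightarrow> 2 \<Rightarrow> real \<Rightarrow> real" where
  "tensor_weight H T i j t = (T *v circle_point t) $ i * (T *v circle_point t) $ j
     * norm (T *v circle_point t) powr (2 * H - 2)"

text \<open>A quadratic \<open>p\<close> times the density composed with \<open>B\<close> has degree
  -2H. The factor ||x||^(2H-2) equals 1 on the circle, so it may be inserted to reach the degree -2
  that \<open>circle_integral_homogeneous\<close> requires; on the image of the circle under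
  \<open>T\<close> it becomes the weight. The determinants of \<open>T\<close> and \<open>B\<close>
  cancel.\<close>

lemma structure_tensor_pullback:
  fixes T B :: "real^2^2"
  assumes H: "0 < H" "H < 1" and X: "anisotropy_function H M X C"
    and Y: "anisotropy_function H M Y (pullback_anisotropy H B C)" and TB: "B ** T = mat 1"
  shows "structure_tensor (pullback_anisotropy H B C) $ i $ j
    = (LINT t:{0..2*pi}|lborel. tensor_weight H T i j t * C (circle_point t))"
proof -
  let ?CY = "pullback_anisotropy H B C"
  let ?f = "\<lambda>\<xi>. norm \<xi> powr (- 2 * H - 2) * C (\<xi> /\<^sub>R norm \<xi>)"
  have f [measurable]: "?f \<in> borel_measurable borel" and f0: "\<And>\<xi>. 0 \<le> ?f \<xi>"
    using X unfolding anisotropy_function_def spectral_density_def by auto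
  have T: "invertible T" using TB by (metis invertible_left_inverse)
  have dets: "\<bar>det T\<bar> * \<bar>det B\<bar> = 1"
    using arg_cong[OF TB, of det] by (simp add: det_mul abs_mult[symmetric] mult.commute)
  have mY: "(\<lambda>t. ?CY (circle_point t)) \<in> borel_measurable borel" and mX: "(\<lambda>t. C (circle_point t)) \<in> borel_measurable borel"
    using anisotropy_on_circle(1)[OF Y] anisotropy_on_circle(1)[OF X] .
  note [measurable] = mX mY
  have eq: "(\<integral>\<^sup>+t. indicator {0..2*pi} t * ennreal (p (circle_point t) * ?CY (circle_point t)) \<partial>lborel)
      = (\<integral>\<^sup>+t. indicator {0..2*pi} t * ennreal (p (T *v circle_point t) * norm (T *v circle_point t) powr (2 * H - 2) * C (circle_point t)) \<partial>lborel)"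
    if p [measurable]: "p \<in> borel_measurable borel" and p0: "\<And>x. 0 \<le> p x" and hom: "\<And>r x. 0 < r \<Longrightarrow> p (r *\<^sub>R x) = r\<^sup>2 * p x"
    for p :: "real^2 \<Rightarrow> real"
  proof -
    let ?F = "\<lambda>\<eta>. p \<eta> * norm \<eta> powr (2 * H - 2) * (\<bar>det B\<bar> * ?f (B *v \<eta>))"
    have circ: "?F (circle_point t) = p (circle_point t) * ?CY (circle_point t)" for t
      by (simp add: pullback_anisotropy_def)
    have circT: "?F (T *v circle_point t) = \<bar>det B\<bar> * (p (T *v circle_point t) * norm (T *v circle_point t) powr (2 * H - 2) * C (circle_point t))" for t
    proof -
      have "B *v (T *v circle_point t) = circle_point t" by (simp add: matrix_vector_mul_assoc TB)
      then show ?thesis by simp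
    qed
    have "(\<integral>\<^sup>+t. indicator {0..2*pi} t * ennreal (?F (circle_point t)) \<partial>lborel)
        = ennreal \<bar>det T\<bar> * (\<integral>\<^sup>+t. indicator {0..2*pi} t * ennreal (?F (T *v circle_point t)) \<partial>lborel)"
    proof (rule circle_integral_homogeneous[OF _ _ _ T])
      show "?F \<in> borel_measurable borel"
        using measurable_compose[OF measurable_matrix_vector_mult f, of B] by measurable
      show "0 \<le> ?F x" for x
        by (rule mult_nonneg_nonneg[OF mult_nonneg_nonneg[OF p0 powr_ge_zero] mult_nonneg_nonneg[OF abs_ge_zero f0]])
      fix r :: real and x assume r: "0 < r"
      have d: "(B *v (r *\<^sub>R x)) /\<^sub>R norm (B *v (r *\<^sub>R x)) = (B *v x) /\<^sub>R norm (B *v x)"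
        using r by (simp add: matrix_vector_mult_scaleR)
      have "r\<^sup>2 * (r powr (2 * H - 2) * r powr (- 2 * H - 2)) = r powr (2 + ((2 * H - 2) + (- 2 * H - 2)))"
        using r by (simp only: powr_add powr_numeral[of r, OF less_imp_le])
      also have "\<dots> = 1 / r\<^sup>2" using r by (simp add: powr_minus_divide)
      finally have "r\<^sup>2 * (r powr (2 * H - 2) * r powr (- 2 * H - 2)) = 1 / r\<^sup>2" .
      then have e: "1 / r\<^sup>2 = r\<^sup>2 * (r powr (2 * H - 2) * r powr (- 2 * H - 2))" ..
      have n: "norm (r *\<^sub>R x) powr a = r powr a * norm x powr a" "norm (B *v (r *\<^sub>R x)) powr a = r powr a * norm (B *v x) powr a" for a
        using r by (simp_all add: powr_mult matrix_vector_mult_scaleR)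
      have "?F (r *\<^sub>R x) = (1 / r\<^sup>2) * ?F x"
        unfolding hom[OF r] d n e by (simp only: ac_simps)
      then show "?F (r *\<^sub>R x) = ?F x / r\<^sup>2" by simp
    qed
    also have "\<dots> = ennreal \<bar>det T\<bar> * (\<integral>\<^sup>+t. ennreal \<bar>det B\<bar> * (indicator {0..2*pi} t
        * ennreal (p (T *v circle_point t) * norm (T *v circle_point t) powr (2 * H - 2) * C (circle_point t))) \<partial>lborel)"
      unfolding circT ennreal_mult'[OF abs_ge_zero, of "det B"]
      by (simp only: mult.left_commute[of "indicator _ _" "ennreal \<bar>det B\<bar>"])
    also have "\<dots> = ennreal (\<bar>det T\<bar> * \<bar>det B\<bar>) * (\<integral>\<^sup>+t. indicator {0..2*pi} t
        * ennreal (p (T *v circle_point t) * norm (T *v circle_point t) powr (2 * H - 2) * C (circle_point t)) \<partial>lborel)"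
      unfolding ennreal_mult'[OF abs_ge_zero, of "det T"] mult.assoc[of "ennreal \<bar>det T\<bar>"]
      by (rule arg_cong[where f = "(*) (ennreal \<bar>det T\<bar>)"], rule nn_integral_cmult) measurable
    finally show ?thesis unfolding circ dets by simp
  qed
  let ?p = "\<lambda>x :: real^2. x $ i * x $ j"
  let ?l = "\<lambda>t. indicator {0..2*pi} t *\<^sub>R (?p (circle_point t) * ?CY (circle_point t))"
  let ?r = "\<lambda>t. indicator {0..2*pi} t *\<^sub>R (tensor_weight H T i j t * C (circle_point t))"
  have pm [measurable]: "?p \<in> borel_measurable borel"
    by (intro borel_measurable_continuous_onI continuous_intros)
  have rm: "?r \<in> borel_measurable lborel"
    using mX measurable_compose[OF measurable_compose[OF measurable_circle_point measurable_matrix_vector_mult[of T]] pm]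
    unfolding tensor_weight_def by measurable
  note cX0 = anisotropy_on_circle(2)[OF X] and cY0 = anisotropy_on_circle(2)[OF Y]
  have pos_part: "ennreal (a * b) = ennreal (max 0 a * b)" if "0 \<le> b" for a b :: real
    using that by (cases "0 \<le> a") (simp_all add: max_def ennreal_neg mult_nonpos_nonneg)
  \<comment> \<open>Off-diagonal entries have no fixed sign. The choices s = 1 and s = -1 give the
    positive and negative parts, whose difference is the real integral.\<close>
  have split: "(\<integral>\<^sup>+t. ennreal (s * ?l t) \<partial>lborel) = (\<integral>\<^sup>+t. ennreal (s * ?r t) \<partial>lborel)" for s
  proof -
    have l: "ennreal (s * ?l t) = indicator {0..2*pi} t * ennreal (max 0 (s * ?p (circle_point t)) * ?CY (circle_point t))" for t
      using pos_part[OF cY0, of "s * ?p (circle_point t)" t] by (cases "t \<in> {0..2*pi}") (simp_all add: mult.assoc)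
    have r: "ennreal (s * ?r t) = indicator {0..2*pi} t * ennreal (max 0 (s * ?p (T *v circle_point t)) * norm (T *v circle_point t) powr (2 * H - 2) * C (circle_point t))" for t
      using pos_part[of "norm (T *v circle_point t) powr (2 * H - 2) * C (circle_point t)" "s * ?p (T *v circle_point t)"] cX0[of t]
      by (cases "t \<in> {0..2*pi}") (simp_all add: mult.assoc tensor_weight_def)
    have hom: "max 0 (s * ?p (r *\<^sub>R x)) = r\<^sup>2 * max 0 (s * ?p x)" for r x
    proof -
      have "s * ?p (r *\<^sub>R x) = r\<^sup>2 * (s * ?p x)" by (simp add: power2_eq_square)
      then show ?thesis by (simp only: max_mult_distrib_left zero_le_power2 if_True mult_zero_right)
    qed
    show ?thesis
      unfolding l r by (rule eq[where p = "\<lambda>x. max 0 (s * ?p x)"])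
        (intro borel_measurable_continuous_onI continuous_intros, simp, rule hom)
  qed
  have p1: "\<bar>?p (circle_point t)\<bar> \<le> 1" for t
    using mult_mono[OF component_le_norm_cart[of "circle_point t" i] component_le_norm_cart[of "circle_point t" j]]
    by (simp add: abs_mult)
  have il: "integrable lborel ?l"
    using set_integrable_mult_bounded[OF anisotropy_integrable[OF H Y] measurable_compose[OF measurable_circle_point pm] p1]
    unfolding set_integrable_def .
  have ir: "integrable lborel ?r"
  proof (rule integrableI_bounded[OF rm])
    have l: "ennreal (norm (?l t)) = indicator {0..2*pi} t * ennreal (\<bar>?p (circle_point t)\<bar> * ?CY (circle_point t))" for t
      using cY0[of t] by (cases "t \<in> {0..2*pi}") (simp_all add: abs_mult)
    have r: "ennreal (norm (?r t)) = indicator {0..2*pi} t * ennreal (\<bar>?p (T *v circle_point t)\<bar> * norm (T *v circle_point t) powr (2 * H - 2) * C (circle_point t))" for t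
      using cX0[of t] by (cases "t \<in> {0..2*pi}") (simp_all add: abs_mult tensor_weight_def)
    have hom: "\<bar>?p (r *\<^sub>R x)\<bar> = r\<^sup>2 * \<bar>?p x\<bar>" for r x
      by (simp add: abs_mult power2_eq_square)
    have "(\<integral>\<^sup>+t. ennreal (norm (?r t)) \<partial>lborel) = (\<integral>\<^sup>+t. ennreal (norm (?l t)) \<partial>lborel)"
      unfolding l r by (rule eq[where p = "\<lambda>x. \<bar>?p x\<bar>", symmetric])
        (intro borel_measurable_continuous_onI continuous_intros, simp, rule hom)
    also have "\<dots> < \<infinity>" using il by (simp add: integrable_iff_bounded)
    finally show "(\<integral>\<^sup>+t. ennreal (norm (?r t)) \<partial>lborel) < \<infinity>" .
  qed
  have "(LINT t|lborel. ?l t) = (LINT t|lborel. ?r t)"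
    unfolding real_lebesgue_integral_def[OF il] real_lebesgue_integral_def[OF ir]
    using split[of 1] split[of "- 1"] by simp
  then show ?thesis
    by (simp add: structure_tensor_def set_lebesgue_integral_def)
qed

section \<open>Expansion in the aperture\<close>

text \<open>The mean value inequality is applied first to the derivative and then to
  \<open>G\<close> minus its linear part, hence K d^2 instead of the sharp K d^2 / 2.\<close>

lemma taylor_linear_error:
  fixes G :: "real \<Rightarrow> real"
  assumes G: "\<And>t. DERIV G t :> G' t" and G': "\<And>t. DERIV G' t :> G'' t"
    and K: "\<And>t. \<bar>t - \<alpha>\<bar> \<le> d \<Longrightarrow> \<bar>G'' t\<bar> \<le> K" and t: "\<bar>t - \<alpha>\<bar> \<le> d"
  shows "\<bar>G t - (G \<alpha> + G' \<alpha> * (t - \<alpha>))\<bar> \<le> K * d\<^sup>2"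
proof -
  have K0: "0 \<le> K" using K[OF t] by (rule order_trans[OF abs_ge_zero])
  have d0: "0 \<le> d" using t by (rule order_trans[OF abs_ge_zero])
  have le: "\<bar>G' s - G' \<alpha>\<bar> \<le> K * d" if "\<bar>s - \<alpha>\<bar> \<le> d" for s
  proof -
    have "norm (G' s - G' \<alpha>) \<le> K * norm (s - \<alpha>)"
      by (rule field_differentiable_bound[where S = "cball \<alpha> d" and f' = G''])
        (use K that d0 G' in \<open>auto simp: dist_real_def abs_minus_commute intro: has_field_derivative_at_within\<close>)
    also have "\<dots> \<le> K * d" using that K0 by (intro mult_left_mono) auto
    finally show ?thesis by simp
  qed
  let ?g = "\<lambda>s. G s - G' \<alpha> * s"
  have D: "(?g has_field_derivative (G' s - G' \<alpha>)) (at s within cball \<alpha> d)" for s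
    by (rule has_field_derivative_at_within) (auto intro!: derivative_eq_intros G)
  have "norm (?g t - ?g \<alpha>) \<le> (K * d) * norm (t - \<alpha>)"
    by (rule field_differentiable_bound[where S = "cball \<alpha> d" and f' = "\<lambda>s. G' s - G' \<alpha>", OF convex_cball D])
      (use le t d0 in \<open>auto simp: dist_real_def abs_minus_commute\<close>)
  also have "\<dots> \<le> (K * d) * d" using t K0 d0 by (intro mult_left_mono) auto
  also have "?g t - ?g \<alpha> = G t - (G \<alpha> + G' \<alpha> * (t - \<alpha>))" by (simp add: algebra_simps)
  finally show ?thesis by (simp add: power2_eq_square mult.assoc)
qed

text \<open>The linear Taylor term has mean zero over an interval centred at \<alpha>, so only the
  second order remainder survives. One bound of \<open>G''\<close> on the interval of radius 1
  serves all \<delta> up to 1.\<close>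

lemma symmetric_average_error:
  fixes G :: "real \<Rightarrow> real"
  assumes G: "\<And>t. DERIV G t :> G' t" and G': "\<And>t. DERIV G' t :> G'' t" and cont: "continuous_on UNIV G''"
  shows "\<exists>K\<ge>0. \<forall>\<delta>. 0 < \<delta> \<and> \<delta> \<le> 1 \<longrightarrow> \<bar>1 / (2 * \<delta>) * integral {\<alpha> - \<delta>..\<alpha> + \<delta>} G - G \<alpha>\<bar> \<le> K * \<delta>\<^sup>2"
proof -
  have "bounded (G'' ` {\<alpha> - 1..\<alpha> + 1})"
    by (intro compact_imp_bounded compact_continuous_image continuous_on_subset[OF cont]) auto
  then obtain K where K: "0 < K" "\<And>t. t \<in> {\<alpha> - 1..\<alpha> + 1} \<Longrightarrow> \<bar>G'' t\<bar> \<le> K"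
    by (auto simp: bounded_pos)
  have "\<bar>1 / (2 * \<delta>) * integral {\<alpha> - \<delta>..\<alpha> + \<delta>} G - G \<alpha>\<bar> \<le> K * \<delta>\<^sup>2" if \<delta>: "0 < \<delta>" "\<delta> \<le> 1" for \<delta>
  proof -
    let ?L = "\<lambda>t. G \<alpha> + G' \<alpha> * (t - \<alpha>)"
    have cG: "continuous_on {a..b} G" for a b
      by (intro continuous_at_imp_continuous_on ballI DERIV_isCont[OF G])
    have "((\<lambda>t. ?L t) has_integral
        (G \<alpha> * (\<alpha> + \<delta>) + G' \<alpha> * (\<alpha> + \<delta> - \<alpha>)\<^sup>2 / 2 - (G \<alpha> * (\<alpha> - \<delta>) + G' \<alpha> * (\<alpha> - \<delta> - \<alpha>)\<^sup>2 / 2))) {\<alpha> - \<delta>..\<alpha> + \<delta>}"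
      using \<delta> by (intro fundamental_theorem_of_calculus)
        (auto intro!: derivative_eq_intros simp: has_real_derivative_iff_has_vector_derivative[symmetric])
    also have "G \<alpha> * (\<alpha> + \<delta>) + G' \<alpha> * (\<alpha> + \<delta> - \<alpha>)\<^sup>2 / 2 - (G \<alpha> * (\<alpha> - \<delta>) + G' \<alpha> * (\<alpha> - \<delta> - \<alpha>)\<^sup>2 / 2) = 2 * \<delta> * G \<alpha>"
      by (simp add: algebra_simps)
    finally have L: "(?L has_integral 2 * \<delta> * G \<alpha>) {\<alpha> - \<delta>..\<alpha> + \<delta>}" .
    have iG: "(G has_integral integral {\<alpha> - \<delta>..\<alpha> + \<delta>} G) {\<alpha> - \<delta>..\<alpha> + \<delta>}"
      by (intro integrable_integral integrable_continuous_real cG)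
    have "norm (integral {\<alpha> - \<delta>..\<alpha> + \<delta>} G - 2 * \<delta> * G \<alpha>) \<le> K * \<delta>\<^sup>2 * measure lborel (cbox (\<alpha> - \<delta>) (\<alpha> + \<delta>))"
    proof (rule has_integral_bound)
      show "((\<lambda>t. G t - ?L t) has_integral (integral {\<alpha> - \<delta>..\<alpha> + \<delta>} G - 2 * \<delta> * G \<alpha>)) (cbox (\<alpha> - \<delta>) (\<alpha> + \<delta>))"
        using has_integral_diff[OF iG L] by simp
      show "norm (G t - ?L t) \<le> K * \<delta>\<^sup>2" if "t \<in> cbox (\<alpha> - \<delta>) (\<alpha> + \<delta>)" for t
        unfolding real_norm_def by (rule taylor_linear_error[OF G G']) (use K(2) that \<delta> in \<open>auto simp: abs_le_iff\<close>)
    qed (use K in auto)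
    then have "\<bar>integral {\<alpha> - \<delta>..\<alpha> + \<delta>} G - 2 * \<delta> * G \<alpha>\<bar> \<le> 2 * \<delta> * (K * \<delta>\<^sup>2)"
      using \<delta> by (simp add: algebra_simps)
    moreover have "1 / (2 * \<delta>) * integral {\<alpha> - \<delta>..\<alpha> + \<delta>} G - G \<alpha> = (integral {\<alpha> - \<delta>..\<alpha> + \<delta>} G - 2 * \<delta> * G \<alpha>) / (2 * \<delta>)"
      using \<delta> by (simp add: diff_divide_distrib)
    ultimately show ?thesis
      using \<delta> by (simp add: abs_divide pos_divide_le_eq mult.commute)
  qed
  then show ?thesis using K(1) by (intro exI[of _ K]) auto
qed

lemma invertible_circle_nonzero:
  assumes "invertible T"
  shows "T *v circle_point t \<noteq> 0"
proof
  assume "T *v circle_point t = 0"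
  then have "T *v circle_point t = T *v 0" by simp
  then have "circle_point t = 0" by (rule injD[OF inj_matrix_vector_mult[OF assms]])
  then show False using norm_circle_point[of t] by simp
qed

text \<open>The power has a negative exponent but its base never vanishes, as \<open>T\<close> is
  invertible. It is written as q^(H-1) with the squared norm \<open>q\<close>; \<open>l\<close>
  gives the coordinates, \<open>m\<close> their derivatives, \<open>r\<close> is half the derivative
  of \<open>q\<close>, and l'' = - l closes the system.\<close>

lemma tensor_weight_smooth:
  assumes T: "invertible T"
  obtains G' G'' where "\<And>t. DERIV (tensor_weight H T i j) t :> G' t" "\<And>t. DERIV G' t :> G'' t" "continuous_on UNIV G''"
proof -
  define l where "l k t = T $ k $ 1 * cos t + T $ k $ 2 * sin t" for k t
  define m where "m k t = T $ k $ 2 * cos t - T $ k $ 1 * sin t" for k t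
  define q where "q t = (l 1 t)\<^sup>2 + (l 2 t)\<^sup>2" for t
  define r where "r t = l 1 t * m 1 t + l 2 t * m 2 t" for t
  define r' where "r' t = (m 1 t)\<^sup>2 + (m 2 t)\<^sup>2 - q t" for t
  have nth: "(T *v circle_point t) $ k = l k t" for k t
    by (simp add: l_def matrix_vector_mult_def sum_2)
  have q_norm: "q t = (norm (T *v circle_point t))\<^sup>2" for t
    by (simp add: q_def norm_vec2 nth)
  have q0: "0 < q t" for t
    using invertible_circle_nonzero[OF T, of t] by (simp add: q_norm)
  have dl: "DERIV (l k) t :> m k t" and dm: "DERIV (m k) t :> - l k t" for k t
    unfolding l_def[abs_def] m_def[abs_def] by (auto intro!: derivative_eq_intros)
  have dq: "DERIV q t :> 2 * r t" for t
    unfolding q_def[abs_def] r_def by (auto intro!: derivative_eq_intros dl simp: algebra_simps)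
  have dr: "DERIV r t :> r' t" for t
    unfolding r_def[abs_def] r'_def q_def by (auto intro!: derivative_eq_intros dl dm simp: power2_eq_square)
  have dp: "DERIV (\<lambda>t. q t powr h) t :> h * q t powr (h - 1) * (2 * r t)" for h t
    using DERIV_fun_powr[OF dq q0, where r = h] by simp
  have cl: "continuous_on UNIV (l k)" and cm: "continuous_on UNIV (m k)" for k
    unfolding l_def[abs_def] m_def[abs_def] by (intro continuous_intros)+
  have cq: "continuous_on UNIV q"
    unfolding q_def[abs_def] by (intro continuous_intros cl)
  have cr: "continuous_on UNIV r" and cr': "continuous_on UNIV r'"
    unfolding r_def[abs_def] r'_def[abs_def] by (intro continuous_intros cl cm cq)+
  have cp: "continuous_on UNIV (\<lambda>t. q t powr h)" for h
    by (intro continuous_at_imp_continuous_on ballI DERIV_isCont[OF dp])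
  let ?h = "H - 1"
  let ?G' = "\<lambda>t. (m i t * l j t + m j t * l i t) * q t powr ?h + ?h * q t powr (?h - 1) * (2 * r t) * (l i t * l j t)"
  let ?G'' = "\<lambda>t. (- l i t * l j t + m j t * m i t + (- l j t * l i t + m i t * m j t)) * q t powr ?h
    + ?h * q t powr (?h - 1) * (2 * r t) * (m i t * l j t + m j t * l i t)
    + ((?h * ((?h - 1) * q t powr (?h - 1 - 1) * (2 * r t)) * (2 * r t) + 2 * r' t * (?h * q t powr (?h - 1))) * (l i t * l j t)
      + (m i t * l j t + m j t * l i t) * (?h * q t powr (?h - 1) * (2 * r t)))"
  have tw: "tensor_weight H T i j = (\<lambda>t. l i t * l j t * q t powr ?h)"
  proof
    fix t
    have "norm (T *v circle_point t) powr (2 * H - 2) = ((norm (T *v circle_point t)) powr 2) powr ?h"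
      using powr_powr[of "norm (T *v circle_point t)" 2 ?h] by (simp only: right_diff_distrib mult_1_right)
    also have "\<dots> = q t powr ?h" by (simp add: q_norm)
    finally show "tensor_weight H T i j t = l i t * l j t * q t powr ?h" by (simp add: tensor_weight_def nth)
  qed
  have 1: "DERIV (tensor_weight H T i j) t :> ?G' t" for t
    unfolding tw by (rule DERIV_mult[OF DERIV_mult[OF dl dl] dp])
  have 2: "DERIV ?G' t :> ?G'' t" for t
    by (rule DERIV_add[OF DERIV_mult[OF DERIV_add[OF DERIV_mult[OF dm dl] DERIV_mult[OF dm dl]] dp]
          DERIV_mult[OF DERIV_mult[OF DERIV_cmult[OF dp] DERIV_cmult[OF dr]] DERIV_mult[OF dl dl]]])
  have 3: "continuous_on UNIV ?G''"
    by (rule cl cm cr cr' cp continuous_on_const continuous_on_add continuous_on_minus continuous_on_mult)+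
  show ?thesis by (rule that[OF 1 2 3])
qed

lemma norm_matrix_le: "norm (J :: real^2^2) \<le> (\<Sum>i\<in>UNIV. \<Sum>j\<in>UNIV. \<bar>J $ i $ j\<bar>)"
proof -
  have "norm J \<le> (\<Sum>i\<in>UNIV. norm (J $ i))"
    unfolding norm_vec_def[of J] by (rule L2_set_le_sum) simp
  also have "\<dots> \<le> (\<Sum>i\<in>UNIV. \<Sum>j\<in>UNIV. \<bar>J $ i $ j\<bar>)"
    by (intro sum_mono norm_le_l1_cart)
  finally show ?thesis .
qed

section \<open>Nondegeneracy of the field and of the Jacobian matrix\<close>

text \<open>A tangent field must be nontrivial for every \<delta>, including those whose arcs
  overlap. A trivial field would have zero angular mass in all directions, against a lower bound on
  a subarc.\<close>

lemma elementary_nontrivial: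
  assumes H: "0 < H" "H < 1" and \<alpha>: "- pi / 2 < \<alpha>" "\<alpha> < pi / 2" and \<delta>: "0 < \<delta>"
    and X: "elementary_field H \<alpha> \<delta> M X"
  shows "\<not> (\<forall>u. AE \<omega> in M. X u \<omega> = 0)"
proof
  assume triv: "\<forall>u. AE \<omega> in M. X u \<omega> = 0"
  let ?c = "\<lambda>t. elementary_anisotropy \<alpha> \<delta> (circle_point t)"
  note X' = X[unfolded elementary_field_def]
  have mass: "angular_mass H ?c u = 0" for u
  proof -
    have "(LINT \<omega>|M. (X u \<omega>)\<^sup>2) = 0"
      using triv[rule_format, of u] by (intro integral_eq_zero_AE) auto
    then show ?thesis
      using variance_eq_mass[OF X', of u] radial_mass_pos[of H] by simp
  qed
  \<comment> \<open>The arc around \<alpha> + pi is used because, cut to radius pi / 2, it lies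
    within [0, 2 pi]; the one around \<alpha> may cross 0.\<close>
  define d where "d = min \<delta> (pi / 2)"
  have d: "0 < d" "d \<le> \<delta>" "d \<le> pi / 2" using \<delta> by (auto simp: d_def)
  have "ennreal (1 / (4 * \<delta>)) * emeasure lborel {\<alpha> + pi - d..\<alpha> + pi + d}
      = (\<integral>\<^sup>+t. ennreal (1 / (4 * \<delta>)) * indicator {\<alpha> + pi - d..\<alpha> + pi + d} t \<partial>lborel)"
    by (simp add: nn_integral_cmult_indicator)
  also have "\<dots> \<le> (\<integral>\<^sup>+t. indicator {0..2*pi} t * ennreal (?c t) \<partial>lborel)"
  proof (rule nn_integral_mono)
    fix t
    show "ennreal (1 / (4 * \<delta>)) * indicator {\<alpha> + pi - d..\<alpha> + pi + d} t \<le> indicator {0..2*pi} t * ennreal (?c t)"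
    proof (cases "t \<in> {\<alpha> + pi - d..\<alpha> + pi + d}")
      case True
      have t: "t \<in> {0..2*pi}" using True d \<alpha> unfolding atLeastAtMost_iff by linarith
      have "arg_within (circle_point t) (\<alpha> + pi - \<delta>) (\<alpha> + pi + \<delta>)"
        unfolding arg_within_circle_point using True d by (intro exI[of _ 0]) auto
      then have "1 / (4 * \<delta>) \<le> ?c t" using \<delta> by (simp add: elementary_anisotropy_def field_simps)
      with True t show ?thesis by (simp add: ennreal_leI)
    qed simp
  qed
  also have "\<dots> = 0"
    using mass_le_angular_mass[OF H anisotropy_on_circle[OF X']] by (simp add: mass)
  finally have "ennreal (1 / (4 * \<delta>)) * emeasure lborel {\<alpha> + pi - d..\<alpha> + pi + d} = 0" by simp
  then show False using d \<delta> by (simp add: ennreal_eq_0_iff)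
qed

text \<open>By the chain rule the derivative of the inverse map is a left inverse of the Jacobian
  matrix; openness of \<open>U\<close> makes the identity hold near \<open>x0\<close>.\<close>

lemma jacobian_invertible:
  assumes "C1_diffeomorphism_on U \<Phi>" "open U" "x0 \<in> U"
  shows "(\<Phi> has_derivative (*v) (jacobian \<Phi> (at x0))) (at x0)" "invertible (jacobian \<Phi> (at x0))"
proof -
  obtain \<Psi> where \<Phi>: "C1_on U \<Phi>" and \<Psi>: "C1_on (\<Phi> ` U) \<Psi>" and inv: "\<And>x. x \<in> U \<Longrightarrow> \<Psi> (\<Phi> x) = x"
    using assms(1) unfolding C1_diffeomorphism_on_def by blast
  obtain \<Phi>' where "(\<Phi> has_derivative \<Phi>') (at x0)"
    using \<Phi> assms(3) unfolding C1_on_def by blast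
  then have "\<Phi> differentiable (at x0)" by (rule differentiableI)
  then show D: "(\<Phi> has_derivative (*v) (jacobian \<Phi> (at x0))) (at x0)"
    unfolding jacobian_works by simp
  obtain \<Psi>' where D': "(\<Psi> has_derivative \<Psi>') (at (\<Phi> x0))"
    using \<Psi> assms(3) unfolding C1_on_def by blast
  have "((\<lambda>x. x) has_derivative (\<lambda>h. \<Psi>' (jacobian \<Phi> (at x0) *v h))) (at x0)"
    by (rule has_derivative_transform_within_open[OF has_derivative_compose[OF D D'] assms(2,3)]) (rule inv)
  then have "(\<lambda>h. \<Psi>' (jacobian \<Phi> (at x0) *v h)) = (\<lambda>h. h)"
    by (rule has_derivative_unique) (rule has_derivative_ident)
  then have "inj ((*v) (jacobian \<Phi> (at x0)))"
    by (intro injI) metis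
  then show "invertible (jacobian \<Phi> (at x0))"
    unfolding invertible_left_inverse matrix_left_invertible_injective .
qed

theorem proposition10:
  fixes H \<alpha>0 :: real
    and M :: "real \<Rightarrow> 'a measure"
    and X :: "real \<Rightarrow> real^2 \<Rightarrow> 'a \<Rightarrow> real"
    and \<Phi> :: "real^2 \<Rightarrow> real^2"
    and U :: "(real^2) set"
    and n x0 :: "real^2"
  assumes "0 < H" and "H < 1"
    and "- pi / 2 < \<alpha>0" and "\<alpha>0 < pi / 2"
    and "\<And>\<delta>. 0 < \<delta> \<Longrightarrow> elementary_field H \<alpha>0 \<delta> (M \<delta>) (X \<delta>)"
    and "n = vector [cos \<alpha>0, sin \<alpha>0]"
    and "C1_on UNIV \<Phi>"
    and "open U" and "C1_diffeomorphism_on U \<Phi>"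
    and "x0 \<in> U"
  shows "approximate_local_orientation H M (\<lambda>\<delta>. warped_field \<Phi> (X \<delta>)) x0
           ((transpose (jacobian \<Phi> (at x0)) *v n) /\<^sub>R norm (transpose (jacobian \<Phi> (at x0)) *v n))"
proof -
  note H = assms(1,2) and \<alpha> = assms(3,4)
  define A where "A = jacobian \<Phi> (at x0)"
  define T where "T = transpose A"
  note X = assms(5)[unfolded elementary_field_def]
  have der: "(\<Phi> has_derivative (*v) A) (at x0)" and A: "invertible A"
    using jacobian_invertible[OF assms(9,8,10)] by (simp_all add: A_def)
  have cont: "continuous_on UNIV \<Phi>"
    using assms(7) unfolding C1_on_def by (intro continuous_at_imp_continuous_on) (blast dest: has_derivative_continuous)
  obtain A' where A': "A' ** A = mat 1" using A unfolding invertible_left_inverse ..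
  define B where "B = transpose A'"
  have TB: "T ** B = mat 1"
    unfolding T_def B_def matrix_transpose_mul[symmetric] A' by (rule transpose_mat)
  then have BT: "B ** T = mat 1" by (simp only: matrix_left_right_inverse)
  have T: "invertible T" unfolding invertible_left_inverse using BT by (rule exI)
  define C where "C \<delta> = pullback_anisotropy H B (elementary_anisotropy \<alpha>0 \<delta>)" for \<delta>
  have Y: "anisotropy_function H (M \<delta>) (\<lambda>u. X \<delta> (A *v u)) (C \<delta>)" if "0 < \<delta>" for \<delta>
    unfolding C_def by (rule anisotropy_function_linear[OF X[OF that] A TB[unfolded T_def]])
  have loc: "localizable_at H (M \<delta>) (warped_field \<Phi> (X \<delta>)) x0 (M \<delta>) (\<lambda>u. X \<delta> (A *v u))" if \<delta>: "0 < \<delta>" for \<delta>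
  proof (rule warped_localizable[OF X[OF \<delta>] cont der])
    show "\<not> (\<forall>u. AE \<omega> in M \<delta>. X \<delta> (A *v u) \<omega> = 0)"
    proof
      assume *: "\<forall>u. AE \<omega> in M \<delta>. X \<delta> (A *v u) \<omega> = 0"
      have "A ** A' = mat 1" using A' by (simp only: matrix_left_right_inverse)
      then have "A *v (A' *v u) = u" for u by (simp add: matrix_vector_mul_assoc)
      then have "AE \<omega> in M \<delta>. X \<delta> u \<omega> = 0" for u using *[rule_format, of "A' *v u"] by simp
      then show False using elementary_nontrivial[OF H \<alpha> \<delta> assms(5)[OF \<delta>]] by blast
    qed
  qed
  have unique: "J = structure_tensor (C \<delta>)"
    if \<delta>: "0 < \<delta>" and J: "local_structure_tensor H (M \<delta>) (warped_field \<Phi> (X \<delta>)) x0 J" for \<delta> J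
  proof -
    obtain N :: "'a measure" and Y' C' where loc': "localizable_at H (M \<delta>) (warped_field \<Phi> (X \<delta>)) x0 N Y'"
      and C': "anisotropy_function H N Y' C'" and J': "J = structure_tensor C'"
      using J unfolding local_structure_tensor_def field_structure_tensor_def by blast
    have G': "gaussian_field N Y'" and G: "gaussian_field (M \<delta>) (\<lambda>u. X \<delta> (A *v u))"
      using C' Y[OF \<delta>] by (simp_all add: anisotropy_function_def)
    show ?thesis
      unfolding J' by (rule structure_tensor_unique[OF H C' Y[OF \<delta>] tangent_variance_unique[OF loc' G' loc[OF \<delta>] G]])
  qed
  let ?v = "T *v circle_point \<alpha>0"
  let ?m = "?v /\<^sub>R norm ?v"
  \<comment> \<open>At the centre the weight is ||v||^(2H-2) v v^T, which is ||v||^(2H) times the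
    tensor of the unit vector; this constant depends neither on \<delta> nor on the chosen
    tensors.\<close>
  let ?c = "norm ?v powr (2 * H)"
  have v: "?v \<noteq> 0" by (rule invertible_circle_nonzero[OF T])
  have center: "tensor_weight H T i j \<alpha>0 = ?c * (?m $ i * ?m $ j)" for i j
  proof -
    have "norm ?v powr (2 * H - 2) = ?c * (inverse (norm ?v) * inverse (norm ?v))"
      using v by (simp add: powr_diff power2_eq_square divide_inverse)
    then show ?thesis by (simp add: tensor_weight_def)
  qed
  \<comment> \<open>The restriction to \<delta> < 1 keeps \<delta> below pi / 2, as
    \<open>elementary_average\<close> requires; the expansion only concerns \<delta> near 0.\<close>
  have "\<exists>K\<ge>0. \<forall>\<delta>. 0 < \<delta> \<and> \<delta> < 1 \<longrightarrow> \<bar>structure_tensor (C \<delta>) $ i $ j - ?c * (?m $ i * ?m $ j)\<bar> \<le> K * \<delta>\<^sup>2" for i j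
  proof -
    obtain G' G'' where G: "\<And>t. DERIV (tensor_weight H T i j) t :> G' t" "\<And>t. DERIV G' t :> G'' t" "continuous_on UNIV G''"
      using tensor_weight_smooth[OF T] by metis
    obtain K where K: "0 \<le> K" "\<And>\<delta>. 0 < \<delta> \<Longrightarrow> \<delta> \<le> 1 \<Longrightarrow>
        \<bar>1 / (2 * \<delta>) * integral {\<alpha>0 - \<delta>..\<alpha>0 + \<delta>} (tensor_weight H T i j) - tensor_weight H T i j \<alpha>0\<bar> \<le> K * \<delta>\<^sup>2"
      using symmetric_average_error[OF G] by blast
    have cG: "continuous_on UNIV (tensor_weight H T i j)"
      by (intro continuous_at_imp_continuous_on ballI DERIV_isCont[OF G(1)])
    have per: "tensor_weight H T i j (t + pi) = tensor_weight H T i j t" for t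
      by (simp add: tensor_weight_def circle_point_periodic linear_neg[OF matrix_vector_mul_linear])
    have "structure_tensor (C \<delta>) $ i $ j = 1 / (2 * \<delta>) * integral {\<alpha>0 - \<delta>..\<alpha>0 + \<delta>} (tensor_weight H T i j)"
      if \<delta>: "0 < \<delta>" "\<delta> < 1" for \<delta>
    proof -
      have "\<delta> < pi / 2" using \<delta> pi_gt3 by simp
      then show ?thesis
        unfolding C_def structure_tensor_pullback[OF H X[OF \<delta>(1)] Y[OF \<delta>(1), unfolded C_def] BT]
        by (rule elementary_average[OF \<delta>(1) _ \<alpha> cG per anisotropy_on_circle(1)[OF X[OF \<delta>(1)]]])
    qed
    then show ?thesis using K unfolding center by (intro exI[of _ K]) auto
  qed
  then obtain K where K: "\<And>i j. 0 \<le> K i j" "\<And>i j \<delta>. 0 < \<delta> \<Longrightarrow> \<delta> < 1 \<Longrightarrow>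
      \<bar>structure_tensor (C \<delta>) $ i $ j - ?c * (?m $ i * ?m $ j)\<bar> \<le> K i j * \<delta>\<^sup>2"
    by metis
  have bigo: "(\<lambda>\<delta>. norm (J \<delta> - ?c *\<^sub>R (\<chi> i j. ?m $ i * ?m $ j))) \<in> O[at_right 0](\<lambda>\<delta>. \<delta>\<^sup>2)"
    if J: "\<forall>\<delta>>0. local_structure_tensor H (M \<delta>) (warped_field \<Phi> (X \<delta>)) x0 (J \<delta>)" for J
  proof (rule bigoI)
    show "\<forall>\<^sub>F \<delta> in at_right 0. norm (norm (J \<delta> - ?c *\<^sub>R (\<chi> i j. ?m $ i * ?m $ j))) \<le> (\<Sum>i\<in>UNIV. \<Sum>j\<in>UNIV. K i j) * norm (\<delta>\<^sup>2)"
    proof (rule eventually_at_rightI)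
      fix \<delta> :: real assume \<delta>: "\<delta> \<in> {0<..<1}"
      then have J\<delta>: "J \<delta> = structure_tensor (C \<delta>)" using unique J by simp
      have "norm (J \<delta> - ?c *\<^sub>R (\<chi> i j. ?m $ i * ?m $ j))
          \<le> (\<Sum>i\<in>UNIV. \<Sum>j\<in>UNIV. \<bar>(J \<delta> - ?c *\<^sub>R (\<chi> i j. ?m $ i * ?m $ j)) $ i $ j\<bar>)"
        by (rule norm_matrix_le)
      also have "\<dots> \<le> (\<Sum>i\<in>UNIV. \<Sum>j\<in>UNIV. K i j * \<delta>\<^sup>2)"
        unfolding J\<delta> using K(2) \<delta> by (intro sum_mono) simp
      also have "\<dots> = (\<Sum>i\<in>UNIV. \<Sum>j\<in>UNIV. K i j) * norm (\<delta>\<^sup>2)"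
        by (simp add: sum_distrib_right)
      finally show "norm (norm (J \<delta> - ?c *\<^sub>R (\<chi> i j. ?m $ i * ?m $ j))) \<le> (\<Sum>i\<in>UNIV. \<Sum>j\<in>UNIV. K i j) * norm (\<delta>\<^sup>2)"
        by simp
    qed simp
  qed
  have n: "n = circle_point \<alpha>0" by (simp add: assms(6) circle_point_def)
  show ?thesis
    unfolding approximate_local_orientation_def n A_def[symmetric] T_def[symmetric]
  proof (intro conjI)
    show "norm ?m = 1" using v by simp
    show "\<forall>\<delta>>0. \<exists>J. local_structure_tensor H (M \<delta>) (warped_field \<Phi> (X \<delta>)) x0 J"
      using loc Y unfolding local_structure_tensor_def field_structure_tensor_def by blast
    show "\<exists>c>0. \<forall>J. (\<forall>\<delta>>0. local_structure_tensor H (M \<delta>) (warped_field \<Phi> (X \<delta>)) x0 (J \<delta>)) \<longrightarrow>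
        (\<lambda>\<delta>. norm (J \<delta> - c *\<^sub>R (\<chi> i j. ?m $ i * ?m $ j))) \<in> O[at_right 0](\<lambda>\<delta>. \<delta>\<^sup>2)"
      using v bigo by (intro exI[of _ ?c] conjI allI impI) auto
  qed
qed

end
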